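(* For every graph $G$, $\rho(G)\le 2\,\mathrm{dsp}(G)+1$, $\ \mathrm{dsp}(G)\le \mathrm{dpr}(G)\le 3\,\mathrm{dsp}(G)$, and $$\mathrm{dsp}(G)\leq \mathrm{dpr}(G)\le \mathrm{pl}(G)\le 4\,\mathrm{dsp}(G)\le 4\,\mathrm{dpr}(G),$$ $$\mathrm{dsp}(G)\leq \mathrm{dpr}(G)\le \Delta(G)\le 4\,\mathrm{dsp}(G)+1\le 4\,\mathrm{dpr}(G)+1,$$ $$\frac{\mathrm{adc}(G)-2}{2}\leq \mathrm{dsp}(G)\leq \mathrm{dpr}(G)\le 2\,\mathrm{adc}(G)+1,$$ $$\frac{\mathrm{adc}(G)}{2}\leq \mathrm{pat}(G)\le \mathrm{pcc}(G)\le 3\,\mathrm{adc}(G)+2,$$ $$\frac{\mathrm{pl}(G)}{2}\leq \mathrm{pat}(G)\le 2\,\mathrm{pl}(G)-1,$$ $$\frac{\Delta(G)-1}{2}\le \mathrm{pat}(G)\le 2\,\Delta(G)-1,$$ $$\mathrm{pat}(G)\le \mathrm{pcc}(G)\le 2\,\mathrm{pat}(G),$$ $$\frac{\mathrm{pl}(G)}{2}\leq \mathrm{pat}(G)\le \mathrm{pcc}(G)\le 2\,\mathrm{pl}(G).$$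
   Context: All graphs are connected, finite, unweighted, undirected, loopless and without multiple edges. $d_G(u,v)$ is the number of edges of a shortest path of $G$ between $u$ and $v$; $d_G(v,S)=\min_{u\in S}d_G(v,u)$; $D_G(v,r)=\{u: d_G(u,v)\le r\}$; the closed neighborhood of $v$ is $N_G[v]=D_G(v,1)$. The power $G^k$ has the same vertex set as $G$, two distinct vertices being adjacent iff their distance in $G$ is at most $k$. A path-decomposition of $G=(V,E)$ is a sequence $X_1,\dots,X_q$ of subsets of $V$ (bags) such that $\bigcup_i X_i=V$; every edge has both ends in some bag; and $X_i\cap X_k\subseteq X_j$ whenever $i\le j\le k$. Its length is $\max_i\max_{u,v\in X_i} d_G(u,v)$; its breadth is the minimum integer $r$ such that every bag $X_i$ is contained in $D_G(v_i,r)$ for some $v_i\in V$. The path-length $\mathrm{pl}(G)$ is the minimum length over all path-decompositions of $G$. For $s\in V$ let $L_i=\{u\in V: d_G(s,u)=i\}$, $i=0,\dots,q$, with $q=\max_u d_G(s,u)$. For $i\ge 1$ let $L_i^+$ be $L_i$ together with all vertices of $L_{i-1}$ that have a neighbor in $L_i$. The sequence $(L_1^+,\dots,L_q^+)$ is a path-decomposition of $G$; $\Delta_s(G)$ and $\rho_s(G)$ denote its length and breadth, and $\Delta(G)=\min_{s\in V}\Delta_s(G)$, $\rho(G)=\min_{s\in V}\rho_s(G)$. A caterpillar tree is an (unweighted) tree in which all vertices are within distance 1 of a central path. $\mathrm{adc}(G)$ is the minimum $k$ such that there is a caterpillar tree $T$ on the vertex set $V$ with $|d_G(u,v)-d_T(u,v)|\le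 k$ for all $u,v\in V$. A path $P$ of $G$ is $k$-dominating if $d_G(v,P)\le k$ for every vertex $v$ of $G$. A pair of vertices $x,y$ is a $k$-dominating pair if every path of $G$ between $x$ and $y$ is $k$-dominating. $\mathrm{dsp}(G)$ is the minimum $k$ such that $G$ has a $k$-dominating shortest path (a $k$-dominating path that is a shortest path of $G$ between its ends); $\mathrm{dpr}(G)$ is the minimum $k$ such that $G$ has a $k$-dominating pair. An asteroidal triple is an independent set of three vertices such that each two are joined by a path avoiding the closed neighborhood of the third. A graph is AT-free if it has no asteroidal triple. A graph is a cocomparability graph if its vertices admit a linear ordering with no triple $x<y<z$ such that $xy$ and $yz$ are non-edges and $xz$ is an edge. $\mathrm{pat}(G)$ (resp. $\mathrm{pcc}(G)$) is the minimum integer $k\ge 1$ such that $G^k$ is AT-free (resp. a cocomparability graph).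
   Formalization: pl(G) ≤ 4 dsp(G) is claimed only when dsp(G) ≥ 1 (it fails for paths with at least 2 vertices, where dsp = 0 and pl = 1); pat(G) ≤ 2pl(G)−1, pat(G) ≤ 2Δ(G)−1 and pcc(G) ≤ 2pl(G) only when G has at least 2 vertices (they fail for one vertex). *)

theory Defs
  imports Complex_Main "Graph_Theory.Graph_Theory"
begin

text \<open>
  A finite simple undirected graph is a \<^locale>\<open>pair_graph\<close> (finite, symmetric, loop-free,
  arcs are pairs of vertices); each edge appears as two opposite arcs.  Paths are vertex
  lists in the sense of \<^const>\<open>vpath\<close>: nonempty, consecutive vertices adjacent, no repetition.
\<close>

definition path_between :: "'a pair_pre_digraph \<Rightarrow> 'a \<Rightarrow> 'a list \<Rightarrow> 'a \<Rightarrow> bool" where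
  "path_between G u p v \<longleftrightarrow> vpath p (with_proj G) \<and> hd p = u \<and> last p = v"

definition gdist :: "'a pair_pre_digraph \<Rightarrow> 'a \<Rightarrow> 'a \<Rightarrow> nat" where
  "gdist G u v = (LEAST n. \<exists>p. path_between G u p v \<and> vwalk_length p = n)"

definition gdist_set :: "'a pair_pre_digraph \<Rightarrow> 'a \<Rightarrow> 'a set \<Rightarrow> nat" where
  "gdist_set G v S = Min (gdist G v ` S)"

definition disk :: "'a pair_pre_digraph \<Rightarrow> 'a \<Rightarrow> nat \<Rightarrow> 'a set" where
  "disk G v r = {u \<in> pverts G. gdist G u v \<le> r}"

definition closed_nbhd :: "'a pair_pre_digraph \<Rightarrow> 'a \<Rightarrow> 'a set" where
  "closed_nbhd G v = disk G v 1"

definition graph_power :: "'a pair_pre_digraph \<Rightarrow> nat \<Rightarrow> 'a pair_pre_digraph" where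
  "graph_power G k =
    \<lparr> pverts = pverts G,
      parcs = {(u, v). u \<in> pverts G \<and> v \<in> pverts G \<and> u \<noteq> v \<and> gdist G u v \<le> k} \<rparr>"


definition path_decomposition :: "'a pair_pre_digraph \<Rightarrow> 'a set list \<Rightarrow> bool" where
  "path_decomposition G Xs \<longleftrightarrow>
    \<Union> (set Xs) = pverts G \<and>
    (\<forall>(u, v) \<in> parcs G. \<exists>X \<in> set Xs. u \<in> X \<and> v \<in> X) \<and>
    (\<forall>i j k. i \<le> j \<and> j \<le> k \<and> k < length Xs \<longrightarrow> Xs ! i \<inter> Xs ! k \<subseteq> Xs ! j)"

text \<open>
  Inserting 0 only matters when no bag contains a vertex; this happens for the empty
  sequence of layers of the one-vertex graph, to which length and breadth 0 are assigned.
\<close>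

definition decomp_length :: "'a pair_pre_digraph \<Rightarrow> 'a set list \<Rightarrow> nat" where
  "decomp_length G Xs =
    Max (insert 0 {gdist G u v | u v. \<exists>X \<in> set Xs. u \<in> X \<and> v \<in> X})"

definition decomp_breadth :: "'a pair_pre_digraph \<Rightarrow> 'a set list \<Rightarrow> nat" where
  "decomp_breadth G Xs = (LEAST r. \<forall>X \<in> set Xs. \<exists>v \<in> pverts G. X \<subseteq> disk G v r)"

definition pl :: "'a pair_pre_digraph \<Rightarrow> nat" where
  "pl G = (LEAST l. \<exists>Xs. path_decomposition G Xs \<and> decomp_length G Xs = l)"


definition layer :: "'a pair_pre_digraph \<Rightarrow> 'a \<Rightarrow> nat \<Rightarrow> 'a set" where
  "layer G s i = {u \<in> pverts G. gdist G s u = i}"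

definition ext_layer :: "'a pair_pre_digraph \<Rightarrow> 'a \<Rightarrow> nat \<Rightarrow> 'a set" where
  "ext_layer G s i =
    layer G s i \<union> {v \<in> layer G s (i - 1). \<exists>u \<in> layer G s i. (v, u) \<in> parcs G}"

definition eccentricity :: "'a pair_pre_digraph \<Rightarrow> 'a \<Rightarrow> nat" where
  "eccentricity G s = Max (gdist G s ` pverts G)"

definition ext_layering :: "'a pair_pre_digraph \<Rightarrow> 'a \<Rightarrow> 'a set list" where
  "ext_layering G s = map (ext_layer G s) [1..<Suc (eccentricity G s)]"

definition Delta :: "'a pair_pre_digraph \<Rightarrow> nat" where
  "Delta G = Min ((\<lambda>s. decomp_length G (ext_layering G s)) ` pverts G)"

definition rho :: "'a pair_pre_digraph \<Rightarrow> nat" where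
  "rho G = Min ((\<lambda>s. decomp_breadth G (ext_layering G s)) ` pverts G)"


text \<open>
  \<^const>\<open>tree\<close> is not usable here: it counts the walk u, v, u along an edge as a cycle, so no
  symmetric digraph with an edge satisfies it.
\<close>

definition undirected_tree :: "'a pair_pre_digraph \<Rightarrow> bool" where
  "undirected_tree T \<longleftrightarrow>
    pair_graph T \<and> connected (with_proj T) \<and>
    \<not> (\<exists>p. vpath p (with_proj T) \<and> length p \<ge> 3 \<and> (last p, hd p) \<in> parcs T)"

definition caterpillar :: "'a pair_pre_digraph \<Rightarrow> bool" where
  "caterpillar T \<longleftrightarrow>
    undirected_tree T \<and>
    (\<exists>p. vpath p (with_proj T) \<and> (\<forall>v \<in> pverts T. gdist_set T v (set p) \<le> 1))"

definition adc :: "'a pair_pre_digraph \<Rightarrow> nat" where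
  "adc G = (LEAST k. \<exists>T. caterpillar T \<and> pverts T = pverts G \<and>
    (\<forall>u \<in> pverts G. \<forall>v \<in> pverts G. \<bar>int (gdist G u v) - int (gdist T u v)\<bar> \<le> int k))"


definition dominating_path :: "'a pair_pre_digraph \<Rightarrow> nat \<Rightarrow> 'a list \<Rightarrow> bool" where
  "dominating_path G k p \<longleftrightarrow>
    vpath p (with_proj G) \<and> (\<forall>v \<in> pverts G. gdist_set G v (set p) \<le> k)"

definition shortest_path :: "'a pair_pre_digraph \<Rightarrow> 'a list \<Rightarrow> bool" where
  "shortest_path G p \<longleftrightarrow>
    vpath p (with_proj G) \<and> vwalk_length p = gdist G (hd p) (last p)"

definition dominating_pair :: "'a pair_pre_digraph \<Rightarrow> nat \<Rightarrow> 'a \<Rightarrow> 'a \<Rightarrow> bool" where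
  "dominating_pair G k x y \<longleftrightarrow>
    x \<in> pverts G \<and> y \<in> pverts G \<and> (\<forall>p. path_between G x p y \<longrightarrow> dominating_path G k p)"

definition dsp :: "'a pair_pre_digraph \<Rightarrow> nat" where
  "dsp G = (LEAST k. \<exists>p. dominating_path G k p \<and> shortest_path G p)"

definition dpr :: "'a pair_pre_digraph \<Rightarrow> nat" where
  "dpr G = (LEAST k. \<exists>x y. dominating_pair G k x y)"


definition joined_avoiding :: "'a pair_pre_digraph \<Rightarrow> 'a \<Rightarrow> 'a \<Rightarrow> 'a \<Rightarrow> bool" where
  "joined_avoiding G u v w \<longleftrightarrow>
    (\<exists>p. path_between G u p v \<and> set p \<inter> closed_nbhd G w = {})"

definition asteroidal_triple :: "'a pair_pre_digraph \<Rightarrow> 'a \<Rightarrow> 'a \<Rightarrow> 'a \<Rightarrow> bool" where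
  "asteroidal_triple G a b c \<longleftrightarrow>
    {a, b, c} \<subseteq> pverts G \<and> distinct [a, b, c] \<and>
    (a, b) \<notin> parcs G \<and> (b, c) \<notin> parcs G \<and> (a, c) \<notin> parcs G \<and>
    joined_avoiding G a b c \<and> joined_avoiding G b c a \<and> joined_avoiding G a c b"

definition AT_free :: "'a pair_pre_digraph \<Rightarrow> bool" where
  "AT_free G \<longleftrightarrow> \<not> (\<exists>a b c. asteroidal_triple G a b c)"

definition cocomparability :: "'a pair_pre_digraph \<Rightarrow> bool" where
  "cocomparability G \<longleftrightarrow>
    (\<exists>vs. distinct vs \<and> set vs = pverts G \<and>
      \<not> (\<exists>i j k. i < j \<and> j < k \<and> k < length vs \<and>
        (vs ! i, vs ! j) \<notin> parcs G \<and> (vs ! j, vs ! k) \<notin> parcs G \<and>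
        (vs ! i, vs ! k) \<in> parcs G))"

definition pat :: "'a pair_pre_digraph \<Rightarrow> nat" where
  "pat G = (LEAST k. k \<ge> 1 \<and> AT_free (graph_power G k))"

definition pcc :: "'a pair_pre_digraph \<Rightarrow> nat" where
  "pcc G = (LEAST k. k \<ge> 1 \<and> cocomparability (graph_power G k))"

end

theory Submission
  imports Defs
begin

text \<open>
  A \<open>k\<close>-dominating shortest path \<open>p\<close> assigns to every vertex the index of a nearby vertex of
  \<open>p\<close>; distances in \<open>G\<close> agree with index differences up to \<open>2 * k\<close>, which gives layerings,
  a path decomposition and a caterpillar with spine \<open>p\<close>. Conversely, ordering the vertices by
  their position along a path decomposition (or along the spine of a caterpillar) and looking at
  the place where a walk passes a given position yields dominating pairs, cocomparability
  orderings of powers and the absence of asteroidal triples.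

  If \<open>G\<^sup>k\<close> is AT-free, it has an admissible vertex \<open>s\<close>: no two vertices \<open>u\<close>, \<open>v\<close> are such that
  each is joined to \<open>s\<close> by a walk avoiding the \<open>k\<close>-disk of the other. Then "\<open>u\<close> is joined to \<open>s\<close>
  by a walk avoiding the \<open>k\<close>-disk of \<open>v\<close>" is a strict partial order on the vertices, and it
  compares any two vertices at distance more than \<open>2 * k\<close> in the direction of their distances
  from \<open>s\<close>. In particular the layers of \<open>s\<close> have diameter at most \<open>2 * k\<close>.
\<close>

section \<open>Walks and distances\<close>

text \<open>Most upper bounds on \<open>pl\<close> and \<open>pcc\<close> come from numeric keys:
  \<open>pl_le_ordering\<close> and \<open>cocomparability_key\<close> turn inequalities about a key
  on the vertices into a path decomposition or a vertex ordering. The keys are left ends of bag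
  intervals, spine indices, distances from \<open>s\<close>, ranks in the precedence order, and
  distance with rank as tie-breaker. Walks are kept as reachability inside a vertex set,
  \<open>rtrancl_on S E\<close>, so that avoiding a disk is a condition on \<open>S\<close> and
  passing from \<open>G\<close> to a power is monotonicity. The crossing lemma below is the discrete
  intermediate value principle behind every step in which a walk has to pass a given position: it
  yields an edge across the position, and an edge jumps only a bounded distance. The factor 2 in the
  cocomparability bounds has one source: if a vertex \<open>m\<close> of a geodesic from
  \<open>x\<close> to \<open>z\<close> is within \<open>r\<close> of \<open>y\<close>, then
  \<open>d x y + d y z\<close> is at most \<open>d x z + 2 * r\<close>.\<close>

lemma rtrancl_on_crossing:
  assumes "(u, v) \<in> rtrancl_on S r" "P u" "\<not> P v"
  shows "\<exists>x y. x \<in> S \<and> y \<in> S \<and> (x, y) \<in> r \<and> P x \<and> \<not> P y"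
  using assms by (induction rule: rtrancl_on_induct) blast+

lemma sym_rtrancl_onD:
  "sym r \<Longrightarrow> (u, v) \<in> rtrancl_on S r \<Longrightarrow> (v, u) \<in> rtrancl_on S r"
  by (rule symD[OF rtrancl_on_sym])

lemma vwalk_rtrancl_on:
  "vwalk p H \<Longrightarrow> (hd p, last p) \<in> rtrancl_on (set p) (arcs_ends H)"
proof (induction rule: vwalk_induct)
  case (Cons u v es)
  have "(v, last (v # es)) \<in> rtrancl_on (set (u # v # es)) (arcs_ends H)"
    by (rule rtrancl_on_mono[OF order_refl _ Cons.IH[unfolded list.sel]]) auto
  then show ?case
    using Cons.hyps by (auto intro: converse_rtrancl_on_into_rtrancl_on)
qed simp

lemma path_between_rtrancl_on:
  "path_between G u p v \<Longrightarrow> (u, v) \<in> rtrancl_on (set p) (parcs G)"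
  using vwalk_rtrancl_on[of p "with_proj G"] by (auto simp: path_between_def vpath_def)

lemma length_vwalk_to_vpath: "length (vwalk_to_vpath p) \<le> length p"
proof (induction p rule: vwalk_to_vpath.induct)
  case (2 x xs)
  then show ?case
    using length_dropWhile_le[of "\<lambda>y. y \<noteq> x" xs] by (auto simp del: length_dropWhile_le)
qed simp

lemma vwalk_path_between:
  assumes "vwalk p (with_proj G)"
  obtains q where "path_between G (hd p) q (last p)" "set q \<subseteq> set p" "length q \<le> length p"
proof
  show "path_between G (hd p) (vwalk_to_vpath p) (last p)"
    using vwalk_to_vpath_vpath[OF assms] vwalk_to_vpath_last[of p] assms
    by (simp add: path_between_def vwalk_to_vpath_hd vwalk_def)
qed (use vwalk_to_vpath_subset length_vwalk_to_vpath in auto)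

lemma rtrancl_on_path_between:
  assumes "(u, v) \<in> rtrancl_on S (parcs G)" "S \<subseteq> pverts G"
  obtains p where "path_between G u p v" "set p \<subseteq> S"
proof -
  have "\<exists>p. vwalk p (with_proj G) \<and> hd p = u \<and> last p = v \<and> set p \<subseteq> S"
    using assms(1)
  proof (induction rule: converse_rtrancl_on_induct)
    case base
    then show ?case using assms(2) by (intro exI[of _ "[v]"]) (auto simp: vwalk_def)
  next
    case (step y z)
    then obtain p where p: "vwalk p (with_proj G)" "hd p = z" "last p = v" "set p \<subseteq> S" by blast
    then have "vwalk (y # p) (with_proj G)"
      using step assms(2) by (intro vwalk_consI) auto
    moreover have "p \<noteq> []" using p(1) by auto
    ultimately show ?case using p step by (intro exI[of _ "y # p"]) auto
  qed
  then show ?thesis by (metis vwalk_path_between subset_trans that)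
qed

lemma path_between_Nil: "\<not> path_between G u [] v"
  by (auto simp: path_between_def)

lemma path_between_ends:
  assumes "path_between G u p v"
  shows "u \<in> set p" "v \<in> set p" "set p \<subseteq> pverts G"
  using assms by (cases "p = []"; auto simp: path_between_def vpath_def vwalk_def)+

lemma vwalk_nth_arc:
  "vwalk p H \<Longrightarrow> Suc i < length p \<Longrightarrow> (p ! i, p ! Suc i) \<in> arcs_ends H"
proof (induction arbitrary: i rule: vwalk_induct)
  case (Cons u v es)
  then show ?case by (cases i) auto
qed simp

section \<open>The metric of a connected graph\<close>

locale conn_graph = pair_graph G for G :: "'a pair_pre_digraph" +
  assumes conn: "connected (with_proj G)"
begin

abbreviation V where "V \<equiv> pverts G"
abbreviation E where "E \<equiv> parcs G"
abbreviation d where "d \<equiv> gdist G"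

lemma fin [simp, intro]: "finite V"
  by (rule pair_finite_verts)

lemma sym_E: "sym E"
  using pair_sym_arcs by (simp add: symmetric_def)

lemma E_symD: "(u, v) \<in> E \<Longrightarrow> (v, u) \<in> E"
  using sym_E by (rule symD)

lemma E_V: "(u, v) \<in> E \<Longrightarrow> u \<in> V \<and> v \<in> V"
  by (auto dest: wellformed')

lemma E_irrefl: "(u, u) \<notin> E"
  using pair_no_loops by fastforce

lemma V_ne: "V \<noteq> {}"
  using conn by (simp add: connected_conv)

lemma symcl_E: "E\<^sup>s = E"
  using symD[OF sym_E] by (fastforce simp: symcl_def)

lemma V_conn: "u \<in> V \<Longrightarrow> v \<in> V \<Longrightarrow> (u, v) \<in> rtrancl_on V E"
  using conn by (simp add: connected_conv symcl_E)

lemma ex_path: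
  assumes "u \<in> V" "v \<in> V"
  obtains p where "path_between G u p v"
  using V_conn[OF assms] by (rule rtrancl_on_path_between) auto

lemma gdist_path:
  assumes "u \<in> V" "v \<in> V"
  obtains p where "path_between G u p v" "vwalk_length p = d u v"
proof -
  from ex_path[OF assms] obtain p where "path_between G u p v" .
  then have "\<exists>n p. path_between G u p v \<and> vwalk_length p = n" by blast
  then have "\<exists>p. path_between G u p v \<and> vwalk_length p = d u v"
    unfolding gdist_def by (rule LeastI_ex)
  then show ?thesis using that by blast
qed

lemma gdist_le_walk:
  assumes "vwalk p (with_proj G)"
  shows "d (hd p) (last p) \<le> length p - 1"
proof -
  from vwalk_path_between[OF assms] obtain q where
    q: "path_between G (hd p) q (last p)" "length q \<le> length p" .
  have "d (hd p) (last p) \<le> vwalk_length q"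
    unfolding gdist_def by (rule Least_le) (use q(1) in blast)
  with q(2) show ?thesis by simp
qed

lemma d_refl [simp]: "u \<in> V \<Longrightarrow> d u u = 0"
  using gdist_le_walk[of "[u]"] by (simp add: vwalk_def)

lemma d_eq_0:
  assumes "u \<in> V" "v \<in> V"
  shows "d u v = 0 \<longleftrightarrow> u = v"
proof
  assume "d u v = 0"
  then obtain p where p: "path_between G u p v" "vwalk_length p = 0"
    using gdist_path[OF assms] by metis
  then show "u = v" by (cases p) (auto simp: path_between_def)
qed (use assms in simp)

lemma d_edge:
  assumes "(u, w) \<in> E" "v \<in> V"
  shows "d u v \<le> Suc (d w v)"
proof -
  from assms E_V have "w \<in> V" "u \<in> V" by auto
  from gdist_path[OF \<open>w \<in> V\<close> assms(2)] obtain p where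
    p: "path_between G w p v" "vwalk_length p = d w v" .
  then have "vwalk (u # p) (with_proj G)" "p \<noteq> []" "last p = v"
    using assms \<open>u \<in> V\<close> by (auto intro!: vwalk_consI simp: path_between_def)
  with gdist_le_walk[of "u # p"] p(2) show ?thesis
    by (cases p) auto
qed

lemma d_step:
  assumes "u \<in> V" "v \<in> V" "d u v = Suc n"
  obtains w where "(u, w) \<in> E" "w \<in> V" "d w v = n"
proof -
  from gdist_path[OF assms(1,2)] obtain p where
    p: "path_between G u p v" "vwalk_length p = Suc n" using assms by metis
  then obtain w q where q: "p = u # w # q"
    by (cases p rule: vwalk_arcs.cases) (auto simp: path_between_def)
  with p have w: "(u, w) \<in> E" "vwalk (w # q) (with_proj G)" "last (w # q) = v" "length q = n"
    by (auto simp: path_between_def vpath_def vwalk_def)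
  then have "d w v \<le> n" using gdist_le_walk[of "w # q"] by simp
  moreover have "Suc n \<le> Suc (d w v)" using d_edge[OF w(1) assms(2)] assms(3) by simp
  ultimately show ?thesis using that w E_V by auto
qed

lemma d_tri:
  assumes "u \<in> V" "w \<in> V" "v \<in> V"
  shows "d u v \<le> d u w + d w v"
  using assms(1)
proof (induction "d u w" arbitrary: u)
  case 0
  then show ?case using d_eq_0 assms by auto
next
  case (Suc n)
  from Suc(2) obtain x where x: "(u, x) \<in> E" "x \<in> V" "d x w = n"
    using d_step[OF Suc(3) assms(2), of n] by metis
  then have "d x v \<le> n + d w v" using Suc(1)[of x] by simp
  moreover have "d u v \<le> Suc (d x v)" using d_edge[OF x(1) assms(3)] .
  ultimately show ?case using Suc(2) by linarith
qed

lemma d_E: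
  assumes "(u, v) \<in> E"
  shows "d u v = 1"
proof -
  have V: "u \<in> V" "v \<in> V" "u \<noteq> v" using assms E_V E_irrefl by auto
  then have "d u v \<noteq> 0" using d_eq_0 by blast
  moreover have "d u v \<le> Suc 0" using d_edge[OF assms V(2)] V by simp
  ultimately show ?thesis by simp
qed

lemma d_le_1:
  assumes "u \<in> V" "v \<in> V"
  shows "d u v \<le> 1 \<longleftrightarrow> u = v \<or> (u, v) \<in> E"
proof
  assume "d u v \<le> 1"
  then consider "d u v = 0" | "d u v = Suc 0" by linarith
  then show "u = v \<or> (u, v) \<in> E"
  proof cases
    case 2
    then show ?thesis using d_step[OF assms 2] d_eq_0 assms by metis
  qed (use assms d_eq_0 in auto)
qed (use assms d_E in auto)

lemma d_sym_le: "u \<in> V \<Longrightarrow> v \<in> V \<Longrightarrow> d v u \<le> d u v"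
proof (induction "d u v" arbitrary: u)
  case 0
  then show ?case using d_eq_0 by auto
next
  case (Suc n)
  from d_step[of u v n] Suc obtain x where x: "(u, x) \<in> E" "x \<in> V" "d x v = n" by metis
  then have "d v x \<le> n" using Suc by auto
  moreover have "d x u = 1" using x E_symD d_E by auto
  ultimately show ?case using d_tri[of v x u] x Suc by auto
qed

lemma d_sym: "u \<in> V \<Longrightarrow> v \<in> V \<Longrightarrow> d v u = d u v"
  using d_sym_le by (simp add: eq_iff)

text \<open>Forgets the vertex list of a shortest path and keeps what is used later: it is a walk,
  and the triangle inequality is an equality at each of its vertices.\<close>

lemma geodesic:
  "u \<in> V \<Longrightarrow> v \<in> V \<Longrightarrow> (u, v) \<in> rtrancl_on {w \<in> V. d u w + d w v = d u v} E"
proof (induction "d u v" arbitrary: u)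
  case 0
  then show ?case using d_eq_0 by auto
next
  case (Suc n)
  from d_step[of u v n] Suc obtain x where x: "(u, x) \<in> E" "x \<in> V" "d x v = n" by metis
  have "{w \<in> V. d x w + d w v = d x v} \<subseteq> {w \<in> V. d u w + d w v = d u v}"
  proof safe
    fix w assume w: "w \<in> V" "d x w + d w v = d x v"
    have "d u w \<le> Suc (d x w)" using d_edge x(1) w(1) .
    moreover have "d u v \<le> d u w + d w v" using d_tri Suc w by auto
    ultimately show "d u w + d w v = d u v" using w x Suc(2) by linarith
  qed
  then have "(x, v) \<in> rtrancl_on {w \<in> V. d u w + d w v = d u v} E"
    using Suc.hyps(1)[OF x(3)[symmetric] x(2) Suc.prems(2)] by (rule rtrancl_on_mono[OF order_refl])
  then show ?case
    by (rule converse_rtrancl_on_into_rtrancl_on[OF x(1)]) (use Suc.prems in simp)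
qed

lemma shortest_path_ex:
  assumes "u \<in> V" "v \<in> V"
  obtains p where "shortest_path G p" "hd p = u" "last p = v" "length p = Suc (d u v)"
proof -
  from gdist_path[OF assms] obtain p where
    p: "path_between G u p v" "vwalk_length p = d u v" .
  moreover have "p \<noteq> []" using p(1) path_between_Nil by metis
  then have "length p = Suc (d u v)" using p(2) by (cases p) auto
  ultimately show ?thesis
    using that[of p] by (simp add: shortest_path_def path_between_def)
qed

lemma vwalk_nth_dist:
  assumes "vwalk p (with_proj G)" "j < length p" "i \<le> j"
  shows "d (p ! i) (p ! j) \<le> j - i"
  using assms(3,2)
proof (induction j rule: dec_induct)
  case base
  then have "p ! i \<in> V" using assms(1) by (auto simp: vwalk_def)
  then show ?case by simp
next
  case (step n)
  have V: "p ! i \<in> V" "p ! n \<in> V" "p ! Suc n \<in> V"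
    using assms(1) step by (auto simp: vwalk_def)
  have "d (p ! n) (p ! Suc n) = 1"
    using vwalk_nth_arc[OF assms(1)] step d_E by simp
  with d_tri[OF V] step show ?case by auto
qed

text \<open>The pieces before \<open>i\<close>, from \<open>i\<close> to \<open>j\<close> and after
  \<open>j\<close> have bounds that add up to the distance of the ends, so none of these bounds can
  be strict.\<close>

lemma shortest_path_nth:
  assumes "shortest_path G p" "i \<le> j" "j < length p"
  shows "d (p ! i) (p ! j) = j - i"
proof -
  let ?m = "length p - 1"
  have w: "vwalk p (with_proj G)" "p \<noteq> []" using assms by (auto simp: shortest_path_def)
  have V: "p ! k \<in> V" if "k < length p" for k using w that by (auto simp: vwalk_def)
  have "d (p ! 0) (p ! ?m) = ?m"
    using assms w by (simp add: shortest_path_def hd_conv_nth last_conv_nth)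
  moreover have "d (p ! 0) (p ! i) \<le> i" "d (p ! j) (p ! ?m) \<le> ?m - j" "d (p ! i) (p ! j) \<le> j - i"
    using vwalk_nth_dist[OF w(1), of i 0] vwalk_nth_dist[OF w(1), of ?m j]
      vwalk_nth_dist[OF w(1), of j i] assms by auto
  moreover have "d (p ! 0) (p ! ?m) \<le> d (p ! 0) (p ! i) + d (p ! i) (p ! j) + d (p ! j) (p ! ?m)"
  proof -
    have "p ! 0 \<in> V" "p ! i \<in> V" "p ! j \<in> V" "p ! ?m \<in> V"
      using V[of 0] V[of i] V[of j] V[of ?m] assms(2,3) w(2) by auto
    with d_tri[of "p!0" "p!i" "p!?m"] d_tri[of "p!i" "p!j" "p!?m"] show ?thesis by linarith
  qed
  ultimately show ?thesis using assms by linarith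
qed

lemma gdist_set_le:
  assumes "finite S" "S \<noteq> {}"
  shows "gdist_set G v S \<le> k \<longleftrightarrow> (\<exists>u\<in>S. d v u \<le> k)"
  unfolding gdist_set_def using assms by (subst Min_le_iff) auto

lemma dominating_path_iff:
  "dominating_path G k p \<longleftrightarrow>
    vpath p (with_proj G) \<and> (\<forall>v\<in>V. \<exists>u\<in>set p. d v u \<le> k)"
proof (cases "vpath p (with_proj G)")
  case True
  then have "set p \<noteq> {}" by auto
  with True show ?thesis by (simp add: dominating_path_def gdist_set_le)
qed (simp add: dominating_path_def)

end

section \<open>Path decompositions and interval representations\<close>

lemma ex_minimizer:
  fixes f :: "'a \<Rightarrow> nat"
  assumes "finite A" "A \<noteq> {}"
  shows "\<exists>x\<in>A. \<forall>y\<in>A. f x \<le> f y"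
proof -
  have "Min (f ` A) \<in> f ` A" using assms by (intro Min_in) auto
  then obtain x where "x \<in> A" "f x = Min (f ` A)" by auto
  then show ?thesis using assms by (intro bexI[of _ x]) auto
qed

lemma ex_maximizer:
  fixes f :: "'a \<Rightarrow> nat"
  assumes "finite A" "A \<noteq> {}"
  shows "\<exists>x\<in>A. \<forall>y\<in>A. f y \<le> f x"
proof -
  have "Max (f ` A) \<in> f ` A" using assms by (intro Max_in) auto
  then obtain x where "x \<in> A" "f x = Max (f ` A)" by auto
  then show ?thesis using assms by (intro bexI[of _ x]) auto
qed

text \<open>A path decomposition reduced to the first and last bag index of each vertex. Two
  vertices share a bag exactly if their index intervals overlap; since arcs come in opposite pairs,
  the second clause says that adjacent intervals overlap.\<close>

definition interval_rep :: "'a pair_pre_digraph \<Rightarrow> ('a \<Rightarrow> nat) \<Rightarrow> ('a \<Rightarrow> nat) \<Rightarrow> nat \<Rightarrow> bool" where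
  "interval_rep G lf rt l \<longleftrightarrow>
    (\<forall>v\<in>pverts G. lf v \<le> rt v) \<and>
    (\<forall>(u, v)\<in>parcs G. lf u \<le> rt v) \<and>
    (\<forall>u\<in>pverts G. \<forall>v\<in>pverts G. lf u \<le> rt v \<longrightarrow> lf v \<le> rt u \<longrightarrow> gdist G u v \<le> l)"

context conn_graph
begin

lemma decomp_length_le_iff:
  assumes "\<Union> (set Xs) \<subseteq> V"
  shows "decomp_length G Xs \<le> l \<longleftrightarrow> (\<forall>X\<in>set Xs. \<forall>u\<in>X. \<forall>v\<in>X. d u v \<le> l)"
proof -
  let ?D = "{d u v | u v. \<exists>X \<in> set Xs. u \<in> X \<and> v \<in> X}"
  have "?D \<subseteq> (\<lambda>(u, v). d u v) ` (V \<times> V)" using assms by auto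
  then have "finite ?D" by (rule finite_subset) auto
  then show ?thesis unfolding decomp_length_def by (subst Max_le_iff) auto
qed

lemma pl_le_decomp: "path_decomposition G Xs \<Longrightarrow> pl G \<le> decomp_length G Xs"
  unfolding pl_def by (rule Least_le) blast

text \<open>The bags are the sets of vertices \<open>u\<close> with \<open>f u \<le> i \<le> max f N[u]\<close>.\<close>

lemma pl_le_ordering:
  fixes f :: "'a \<Rightarrow> nat"
  assumes f: "\<And>u v w. u \<in> V \<Longrightarrow> v \<in> V \<Longrightarrow> w \<in> V \<Longrightarrow> w = u \<or> (u, w) \<in> E \<Longrightarrow>
    f u \<le> f v \<Longrightarrow> f v \<le> f w \<Longrightarrow> d u v \<le> l"
  shows "pl G \<le> l"
proof -
  define N where "N u = insert u (E `` {u})" for u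
  define rt where "rt u = Max (f ` N u)" for u
  have N: "finite (N u)" "N u \<noteq> {}" if "u \<in> V" for u
  proof -
    have "N u \<subseteq> V" using that E_V by (auto simp: N_def)
    then show "finite (N u)" using finite_subset by blast
  qed (auto simp: N_def)
  have rt_ge: "f w \<le> rt u" if "u \<in> V" "w \<in> N u" for u w
    unfolding rt_def using that N[of u] by (intro Max_ge) auto
  have rt_ex: "\<exists>w\<in>N u. rt u = f w" if "u \<in> V" for u
  proof -
    have "Max (f ` N u) \<in> f ` N u" using N[OF that] by (intro Max_in) auto
    then show ?thesis by (auto simp: rt_def)
  qed
  define bag where "bag i = {u \<in> V. f u \<le> i \<and> i \<le> rt u}" for i
  define n where "n = Suc (Max (f ` V))"
  define Xs where "Xs = map bag [0..<n]"
  have fn: "f v < n" if "v \<in> V" for v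
    unfolding n_def using that by (auto intro: Max_ge simp: less_Suc_eq_le)
  have self: "v \<in> bag (f v)" if "v \<in> V" for v
    using that rt_ge[of v v] by (auto simp: bag_def N_def)
  have set: "set Xs = bag ` {..<n}" by (auto simp: Xs_def)
  have edge: "\<exists>X\<in>set Xs. u \<in> X \<and> v \<in> X" if "(u, v) \<in> E" "f u \<le> f v" for u v
  proof
    from that E_V have "u \<in> V" "v \<in> V" by auto
    then show "bag (f v) \<in> set Xs" using fn set by auto
    show "u \<in> bag (f v) \<and> v \<in> bag (f v)"
      using that rt_ge[of u v] \<open>u \<in> V\<close> self[OF \<open>v \<in> V\<close>] by (auto simp: bag_def N_def)
  qed
  have pd: "path_decomposition G Xs"
    unfolding path_decomposition_def
  proof (intro conjI allI impI)
    show "\<Union> (set Xs) = V"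
    proof
      show "\<Union> (set Xs) \<subseteq> V" by (auto simp: set bag_def)
      show "V \<subseteq> \<Union> (set Xs)" using self fn by (force simp: set)
    qed
    have "\<exists>X\<in>set Xs. u \<in> X \<and> v \<in> X" if "(u, v) \<in> E" for u v
      using edge[of u v] edge[of v u] that E_symD[OF that] by (metis nle_le)
    then show "\<forall>(u, v)\<in>E. \<exists>X\<in>set Xs. u \<in> X \<and> v \<in> X" by blast
    fix i j k assume "i \<le> j \<and> j \<le> k \<and> k < length Xs"
    then show "Xs ! i \<inter> Xs ! k \<subseteq> Xs ! j" by (auto simp: Xs_def bag_def)
  qed
  \<comment> \<open>Membership in \<open>bag i\<close> gives \<open>f v \<le> i \<le> rt u\<close>,
    so \<open>v\<close> lies between \<open>u\<close> and the member of \<open>N u\<close> that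
    attains \<open>rt u\<close>, as in the hypothesis on \<open>f\<close>.\<close>
  have close: "d u v \<le> l" if "u \<in> bag i" "v \<in> bag i" "f u \<le> f v" for i u v
  proof -
    have V: "u \<in> V" "v \<in> V" using that by (auto simp: bag_def)
    from rt_ex[OF V(1)] obtain w where w: "w \<in> N u" "rt u = f w" by blast
    then have "f v \<le> f w" using that by (auto simp: bag_def)
    then show ?thesis using f[of u v w] V w that(3) E_V by (auto simp: N_def)
  qed
  have "d u v \<le> l" if "u \<in> bag i" "v \<in> bag i" for i u v
  proof (cases "f u \<le> f v")
    case False
    then have "d v u \<le> l" using close that by (metis nle_le)
    moreover have "u \<in> V" "v \<in> V" using that by (auto simp: bag_def)
    ultimately show ?thesis using d_sym by simp
  qed (use close that in blast)
  then have "decomp_length G Xs \<le> l"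
    by (subst decomp_length_le_iff) (auto simp: set bag_def)
  with pl_le_decomp[OF pd] show ?thesis by linarith
qed

lemma pl_interval_rep: obtains lf rt where "interval_rep G lf rt (pl G)"
proof -
  have "path_decomposition G [V]"
    using E_V by (auto simp: path_decomposition_def)
  then have "\<exists>l Xs. path_decomposition G Xs \<and> decomp_length G Xs = l" by blast
  then have "\<exists>Xs. path_decomposition G Xs \<and> decomp_length G Xs = pl G"
    unfolding pl_def by (rule LeastI_ex)
  then obtain Xs where Xs: "path_decomposition G Xs" "decomp_length G Xs = pl G" by blast
  have UV: "\<Union> (set Xs) = V"
    and edge: "\<And>u v. (u, v) \<in> E \<Longrightarrow> \<exists>X\<in>set Xs. u \<in> X \<and> v \<in> X"
    and conv: "\<And>i j k. i \<le> j \<Longrightarrow> j \<le> k \<Longrightarrow> k < length Xs \<Longrightarrow> Xs ! i \<inter> Xs ! k \<subseteq> Xs ! j"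
    using Xs(1) by (auto simp: path_decomposition_def simp del: Union_iff)
  have len: "d u v \<le> pl G" if "u \<in> Xs ! i" "v \<in> Xs ! i" "i < length Xs" for u v i
  proof -
    have "\<forall>X\<in>set Xs. \<forall>u\<in>X. \<forall>v\<in>X. d u v \<le> pl G"
      using decomp_length_le_iff[of Xs "pl G"] Xs(2) UV by simp
    then show ?thesis using that nth_mem[OF that(3)] by blast
  qed
  define I where "I v = {i. i < length Xs \<and> v \<in> Xs ! i}" for v
  have fin_I: "finite (I v)" for v by (simp add: I_def)
  have ne: "I v \<noteq> {}" if "v \<in> V" for v
  proof -
    from that UV obtain X where "X \<in> set Xs" "v \<in> X" by blast
    then show ?thesis by (auto simp: I_def in_set_conv_nth)
  qed
  have Min: "Min (I v) \<in> I v" "Max (I v) \<in> I v" if "v \<in> V" for v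
    using fin_I ne[OF that] by auto
  \<comment> \<open>Overlapping intervals both contain the larger of their left ends, here that of
    \<open>v\<close>.\<close>
  have common: "d u v \<le> pl G"
    if V: "u \<in> V" "v \<in> V" and le: "Min (I v) \<le> Max (I u)" "Min (I u) \<le> Min (I v)" for u v
  proof -
    have "u \<in> Xs ! Min (I v)"
      using conv[OF le(2,1)] Min[OF V(1)] by (auto simp: I_def)
    moreover have "v \<in> Xs ! Min (I v)" "Min (I v) < length Xs"
      using Min[OF V(2)] by (auto simp: I_def)
    ultimately show ?thesis using len by blast
  qed
  have "interval_rep G (\<lambda>v. Min (I v)) (\<lambda>v. Max (I v)) (pl G)"
    unfolding interval_rep_def
  proof (intro conjI ballI impI)
    fix v assume "v \<in> V"
    then show "Min (I v) \<le> Max (I v)" using Min fin_I Max_ge by metis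
  next
    have "Min (I u) \<le> Max (I v)" if "(u, v) \<in> E" for u v
    proof -
      from edge[OF that] obtain i where "i \<in> I u" "i \<in> I v" by (auto simp: I_def in_set_conv_nth)
      then have "Min (I u) \<le> i" "i \<le> Max (I v)" using fin_I by auto
      then show ?thesis by linarith
    qed
    then show "\<And>x. x \<in> E \<Longrightarrow> case x of (u, v) \<Rightarrow> Min (I u) \<le> Max (I v)" by auto
  next
    fix u v assume V: "u \<in> V" "v \<in> V" and le: "Min (I u) \<le> Max (I v)" "Min (I v) \<le> Max (I u)"
    show "d u v \<le> pl G"
    proof (cases "Min (I u) \<le> Min (I v)")
      case False
      then have "d v u \<le> pl G" using common[OF V(2,1) le(1)] by linarith
      then show ?thesis using d_sym V by simp
    qed (use common V le in blast)
  qed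
  then show ?thesis using that by blast
qed

text \<open>Consider the edge on which the left end first exceeds \<open>rt y\<close>. The intervals
  of its ends overlap, so the earlier vertex ends beyond \<open>rt y\<close> but starts before it:
  its interval meets that of \<open>y\<close>.\<close>

lemma interval_cross:
  assumes rep: "interval_rep G lf rt l" and S: "(x, z) \<in> rtrancl_on S E" "S \<subseteq> V"
    and y: "lf x \<le> rt y" "lf y \<le> rt z" "y \<in> V"
  shows "\<exists>m\<in>S. d m y \<le> l"
proof -
  have ov: "d m y \<le> l" if "m \<in> S" "lf m \<le> rt y" "lf y \<le> rt m" for m
    using rep y(3) that S(2) by (auto simp: interval_rep_def)
  show ?thesis
  proof (cases "lf z \<le> rt y")
    case True
    then show ?thesis using ov[of z] y in_rtrancl_on_in_F[OF S(1)] by blast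
  next
    case False
    then obtain q q' where q: "q \<in> S" "(q, q') \<in> E" "lf q \<le> rt y" "\<not> lf q' \<le> rt y"
      using rtrancl_on_crossing[OF S(1), of "\<lambda>q. lf q \<le> rt y"] y by blast
    have "lf q' \<le> rt q" using rep E_symD[OF q(2)] by (auto simp: interval_rep_def)
    moreover have "lf y \<le> rt y" using rep y by (auto simp: interval_rep_def)
    ultimately show ?thesis using ov[of q] q by force
  qed
qed

lemma interval_midpoint:
  assumes "interval_rep G lf rt l" "x \<in> V" "y \<in> V" "z \<in> V" "lf x \<le> rt y" "lf y \<le> rt z"
  shows "\<exists>m\<in>V. d x m + d m z = d x z \<and> d m y \<le> l"
  using interval_cross[OF assms(1) geodesic[OF assms(2,4)] _ assms(5,6,3)] by auto

lemma dpr_le: "dominating_pair G k x y \<Longrightarrow> dpr G \<le> k"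
  unfolding dpr_def by (rule Least_le) blast

text \<open>The pair consists of a vertex whose interval ends first and one whose interval starts
  last. Every path between them crosses every interval.\<close>

lemma pl_dominating_pair: "\<exists>x y. dominating_pair G (pl G) x y"
proof -
  from pl_interval_rep obtain lf rt where rep: "interval_rep G lf rt (pl G)" .
  have "\<exists>x\<in>V. \<forall>v\<in>V. rt x \<le> rt v"
    by (rule ex_minimizer) (use V_ne in auto)
  then obtain x where x: "x \<in> V" "\<And>v. v \<in> V \<Longrightarrow> rt x \<le> rt v" by blast
  have "\<exists>y\<in>V. \<forall>v\<in>V. lf v \<le> lf y"
    by (rule ex_maximizer) (use V_ne in auto)
  then obtain y where y: "y \<in> V" "\<And>v. v \<in> V \<Longrightarrow> lf v \<le> lf y" by blast
  have le: "lf v \<le> rt v" if "v \<in> V" for v using rep that by (simp add: interval_rep_def)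
  have "dominating_path G (pl G) p" if p: "path_between G x p y" for p
    unfolding dominating_path_iff
  proof (intro conjI ballI)
    show "vpath p (with_proj G)" using p by (simp add: path_between_def)
    fix v assume v: "v \<in> V"
    have "lf x \<le> rt v" "lf v \<le> rt y" using x y v le by (meson order_trans)+
    then obtain m where "m \<in> set p" "d m v \<le> pl G"
      using interval_cross[OF rep path_between_rtrancl_on[OF p] path_between_ends(3)[OF p]] v by blast
    then show "\<exists>u\<in>set p. d v u \<le> pl G" using d_sym v path_between_ends(3)[OF p] by force
  qed
  then show ?thesis using x y by (auto simp: dominating_pair_def)
qed

lemma dpr_le_pl: "dpr G \<le> pl G"
  using pl_dominating_pair dpr_le by blast

lemma dpr_dominating_pair: obtains x y where "dominating_pair G (dpr G) x y"
proof -
  have "\<exists>k x y. dominating_pair G k x y" using pl_dominating_pair by blast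
  from LeastI_ex[OF this] show ?thesis using that by (auto simp: dpr_def)
qed

lemma pl_ge_1:
  assumes "card V \<ge> 2"
  shows "pl G \<ge> 1"
proof -
  obtain u v where uv: "u \<in> V" "v \<in> V" "u \<noteq> v"
    using assms by (metis card_le_Suc0_iff_eq fin not_less_eq_eq numeral_2_eq_2)
  then obtain n where "d u v = Suc n" using d_eq_0 by (meson not0_implies_Suc)
  then obtain w where w: "(u, w) \<in> E" "w \<in> V" using d_step uv by metis
  from pl_interval_rep obtain lf rt where rep: "interval_rep G lf rt (pl G)" .
  then have "lf u \<le> rt w" "lf w \<le> rt u" using w E_symD[OF w(1)] by (auto simp: interval_rep_def)
  then have "d u w \<le> pl G" using rep w uv by (auto simp: interval_rep_def)
  then show ?thesis using d_E[OF w(1)] by simp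
qed

end

section \<open>Powers, asteroidal triples and cocomparability orderings\<close>

text \<open>The set \<open>A\<close> without the closed neighborhood of \<open>w\<close>. A bare
  relation and a vertex set are taken instead of a graph because the induction for admissible
  vertices shrinks \<open>A\<close> and keeps \<open>r\<close>.\<close>

definition far :: "'a rel \<Rightarrow> 'a set \<Rightarrow> 'a \<Rightarrow> 'a set" where
  "far r A w = {x \<in> A. x \<noteq> w \<and> (w, x) \<notin> r}"

text \<open>\<open>sort_key\<close> resolves ties of \<open>f\<close> by the position in an
  arbitrary list, which is why the condition is stated with weak inequalities.\<close>

lemma cocomparability_key:
  fixes f :: "'a \<Rightarrow> nat"
  assumes fin: "finite (pverts H)"
    and f: "\<And>x y z. x \<in> pverts H \<Longrightarrow> y \<in> pverts H \<Longrightarrow> z \<in> pverts H \<Longrightarrow> x \<noteq> y \<Longrightarrow> y \<noteq> z \<Longrightarrow>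
      f x \<le> f y \<Longrightarrow> f y \<le> f z \<Longrightarrow> (x, y) \<notin> parcs H \<Longrightarrow> (y, z) \<notin> parcs H \<Longrightarrow> (x, z) \<notin> parcs H"
  shows "cocomparability H"
proof -
  from finite_distinct_list[OF fin] obtain xs where xs: "set xs = pverts H" "distinct xs" by blast
  define vs where "vs = sort_key f xs"
  have vs: "set vs = pverts H" "distinct vs" using xs by (auto simp: vs_def)
  have "sorted (map f vs)" by (simp add: vs_def)
  then have le: "f (vs ! i) \<le> f (vs ! j)" if "i \<le> j" "j < length vs" for i j
    using that sorted_nth_mono[of "map f vs" i j] by simp
  have "(vs ! i, vs ! k) \<notin> parcs H"
    if "i < j" "j < k" "k < length vs" "(vs ! i, vs ! j) \<notin> parcs H" "(vs ! j, vs ! k) \<notin> parcs H"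
    for i j k
    using that le f[of "vs ! i" "vs ! j" "vs ! k"] nth_mem[of _ vs] vs
    by (simp add: nth_eq_iff_index_eq)
  then show ?thesis using vs unfolding cocomparability_def by blast
qed

context conn_graph
begin

lemma joined_avoiding_iff:
  assumes "w \<in> V"
  shows "joined_avoiding G u v w \<longleftrightarrow> (u, v) \<in> rtrancl_on (far E V w) E"
proof -
  have far: "far E V w = V - closed_nbhd G w"
    using d_le_1[OF assms] by (auto simp: far_def closed_nbhd_def disk_def d_sym[OF assms])
  show ?thesis
  proof
    assume "joined_avoiding G u v w"
    then obtain p where p: "path_between G u p v" "set p \<inter> closed_nbhd G w = {}"
      by (auto simp: joined_avoiding_def)
    show "(u, v) \<in> rtrancl_on (far E V w) E"
      by (rule rtrancl_on_mono[OF order_refl _ path_between_rtrancl_on[OF p(1)]])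
        (use path_between_ends(3)[OF p(1)] p(2) far in auto)
  next
    assume "(u, v) \<in> rtrancl_on (far E V w) E"
    then obtain p where "path_between G u p v" "set p \<subseteq> far E V w"
      using rtrancl_on_path_between by (metis (no_types) Diff_subset far)
    then show "joined_avoiding G u v w" using far by (auto simp: joined_avoiding_def)
  qed
qed

text \<open>The ends of each walk lie outside the closed neighborhood of the third vertex; this
  yields distinctness and independence.\<close>

lemma AT_free_iff:
  "AT_free G \<longleftrightarrow> \<not> (\<exists>a\<in>V. \<exists>b\<in>V. \<exists>c\<in>V. (a, b) \<in> rtrancl_on (far E V c) E \<and>
    (b, c) \<in> rtrancl_on (far E V a) E \<and> (a, c) \<in> rtrancl_on (far E V b) E)"
proof -
  have "asteroidal_triple G a b c \<longleftrightarrow> a \<in> V \<and> b \<in> V \<and> c \<in> V \<and>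
    (a, b) \<in> rtrancl_on (far E V c) E \<and>
    (b, c) \<in> rtrancl_on (far E V a) E \<and> (a, c) \<in> rtrancl_on (far E V b) E" (is "?L \<longleftrightarrow> ?R") for a b c
  proof
    show "?L \<Longrightarrow> ?R" by (auto simp: asteroidal_triple_def joined_avoiding_iff)
    assume R: ?R
    then have "a \<in> far E V c" "b \<in> far E V c" "b \<in> far E V a" "c \<in> far E V a"
      "a \<in> far E V b" "c \<in> far E V b"
      by (blast dest: in_rtrancl_on_in_F)+
    with R show ?L by (auto simp: asteroidal_triple_def joined_avoiding_iff far_def)
  qed
  then show ?thesis unfolding AT_free_def by blast
qed

text \<open>Up to reversal of walks the three vertices play the same role, so the one with the
  middle key can be singled out together with the walk that avoids it.\<close>

lemma AT_middle:
  fixes f :: "'a \<Rightarrow> nat"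
  assumes "\<not> AT_free G"
  obtains x y z where "x \<in> V" "y \<in> V" "z \<in> V" "f x \<le> f y" "f y \<le> f z"
    "(x, z) \<in> rtrancl_on (far E V y) E"
proof -
  from assms obtain a b c where abc: "a \<in> V" "b \<in> V" "c \<in> V"
    "(a, b) \<in> rtrancl_on (far E V c) E" "(b, c) \<in> rtrancl_on (far E V a) E"
    "(a, c) \<in> rtrancl_on (far E V b) E"
    by (auto simp: AT_free_iff)
  note rev = abc(4-6)[THEN sym_rtrancl_onD[OF sym_E]]
  consider "f a \<le> f b" "f b \<le> f c" | "f c \<le> f b" "f b \<le> f a" | "f a \<le> f c" "f c \<le> f b"
    | "f b \<le> f c" "f c \<le> f a" | "f b \<le> f a" "f a \<le> f c" | "f c \<le> f a" "f a \<le> f b" by linarith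
  then show ?thesis using that abc rev by cases blast+
qed

text \<open>The walk avoiding the middle vertex \<open>y\<close> has an edge from a position before
  \<open>y\<close> to one after \<open>y\<close>. Neither end is adjacent to \<open>y\<close>, so
  they form a forbidden triple with it.\<close>

lemma cocomparability_AT_free:
  assumes "cocomparability G"
  shows "AT_free G"
proof (rule ccontr)
  assume at: "\<not> AT_free G"
  from assms obtain vs where vs: "distinct vs" "set vs = V"
    "\<And>i j k. i < j \<Longrightarrow> j < k \<Longrightarrow> k < length vs \<Longrightarrow> (vs ! i, vs ! j) \<notin> E \<Longrightarrow> (vs ! j, vs ! k) \<notin> E
      \<Longrightarrow> (vs ! i, vs ! k) \<notin> E"
    unfolding cocomparability_def by blast
  define f where "f v = (THE i. i < length vs \<and> vs ! i = v)" for v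
  have f: "f v < length vs \<and> vs ! f v = v" if "v \<in> V" for v
    unfolding f_def by (rule theI', rule distinct_Ex1[OF vs(1)]) (use that vs(2) in simp)
  from AT_middle[OF at, of f] obtain x y z where xyz: "x \<in> V" "y \<in> V" "z \<in> V" "f x \<le> f y" "f y \<le> f z"
    "(x, z) \<in> rtrancl_on (far E V y) E" by blast
  then have "z \<in> far E V y" by (blast dest: in_rtrancl_on_in_F)
  then have "z \<noteq> y" by (simp add: far_def)
  then have "\<not> f z \<le> f y" using f[OF xyz(2)] f[OF xyz(3)] xyz(5) by (metis le_antisym)
  then obtain q q' where q: "q \<in> far E V y" "q' \<in> far E V y" "(q, q') \<in> E" "f q \<le> f y" "\<not> f q' \<le> f y"
    using rtrancl_on_crossing[OF xyz(6), of "\<lambda>q. f q \<le> f y"] xyz(4) by blast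
  then have V: "q \<in> V" "q' \<in> V" "q \<noteq> y" "(q, y) \<notin> E" "(y, q') \<notin> E"
    using E_symD by (auto simp: far_def)
  then have "f q \<noteq> f y" using f xyz(2) by metis
  then show False using vs(3)[of "f q" "f y" "f q'"] f V q xyz(2) by auto
qed

section \<open>Powers of a graph and interval representations\<close>

lemma graph_power_arcs [simp]:
  "(u, v) \<in> parcs (graph_power G k) \<longleftrightarrow> u \<in> V \<and> v \<in> V \<and> u \<noteq> v \<and> d u v \<le> k"
  by (simp add: graph_power_def)

lemma graph_power_verts [simp]: "pverts (graph_power G k) = V"
  by (simp add: graph_power_def)

lemma E_subset_power: "k \<ge> 1 \<Longrightarrow> E \<subseteq> parcs (graph_power G k)"
proof (intro subrelI)
  fix u v assume "k \<ge> 1" "(u, v) \<in> E"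
  then show "(u, v) \<in> parcs (graph_power G k)" using E_V d_E[of u v] E_irrefl by auto
qed

lemma conn_graph_power:
  assumes "k \<ge> 1"
  shows "conn_graph (graph_power G k)"
proof -
  let ?H = "graph_power G k"
  have "sym (parcs ?H)" using d_sym by (auto intro: symI)
  moreover have "parcs ?H \<subseteq> V \<times> V" by auto
  then have "finite (parcs ?H)" by (rule finite_subset) auto
  ultimately have "pair_graph ?H"
    by unfold_locales (auto simp: symmetric_def)
  moreover have "(u, v) \<in> rtrancl_on V ((parcs ?H)\<^sup>s)" if "u \<in> V" "v \<in> V" for u v
    by (rule rtrancl_on_mono[OF _ order_refl V_conn[OF that]])
      (use E_subset_power[OF assms] in \<open>auto simp: symcl_def\<close>)
  then have "connected (with_proj ?H)"
    using V_ne by (simp add: connected_conv)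
  ultimately show ?thesis by (simp add: conn_graph_def conn_graph_axioms_def)
qed

lemma far_power:
  assumes "y \<in> V"
  shows "far (parcs (graph_power G k)) V y = {x \<in> V. d x y > k}"
  using assms d_sym by (auto simp: far_def)

lemma pat_le: "k \<ge> 1 \<Longrightarrow> AT_free (graph_power G k) \<Longrightarrow> pat G \<le> k"
  unfolding pat_def by (rule Least_le) blast

lemma pcc_le: "k \<ge> 1 \<Longrightarrow> cocomparability (graph_power G k) \<Longrightarrow> pcc G \<le> k"
  unfolding pcc_def by (rule Least_le) blast

text \<open>A geodesic from \<open>x\<close> to \<open>z\<close> passes within \<open>l\<close> of
  \<open>y\<close>. If \<open>x\<close> and \<open>z\<close> are both more than \<open>2 * l\<close>
  from \<open>y\<close>, each of its two parts is longer than \<open>l\<close>.\<close>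

lemma cocomparability_power_interval:
  assumes rep: "interval_rep G lf rt l"
  shows "cocomparability (graph_power G (2 * l))"
proof (rule cocomparability_key[where f = lf])
  fix x y z
  assume "x \<in> pverts (graph_power G (2 * l))" "y \<in> pverts (graph_power G (2 * l))"
    "z \<in> pverts (graph_power G (2 * l))"
  then have V: "x \<in> V" "y \<in> V" "z \<in> V" by auto
  assume ne: "x \<noteq> y" "y \<noteq> z" and le: "lf x \<le> lf y" "lf y \<le> lf z"
    and na: "(x, y) \<notin> parcs (graph_power G (2 * l))" "(y, z) \<notin> parcs (graph_power G (2 * l))"
  have "lf y \<le> rt y" "lf z \<le> rt z" using rep V by (auto simp: interval_rep_def)
  then obtain m where m: "m \<in> V" "d x m + d m z = d x z" "d m y \<le> l"
    using interval_midpoint[OF rep V] le by force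
  have "d x y > 2 * l" "d y z > 2 * l" using na ne V by auto
  moreover have "d x y \<le> d x m + d m y" "d y z \<le> d m y + d m z"
    using d_tri V m(1) d_sym[OF m(1) V(2)] by metis+
  ultimately have "d x z > 2 * l" using m by linarith
  then show "(x, z) \<notin> parcs (graph_power G (2 * l))" by simp
qed simp

lemma pcc_le_2pl:
  assumes "card V \<ge> 2"
  shows "pcc G \<le> 2 * pl G"
proof -
  from pl_interval_rep obtain lf rt where "interval_rep G lf rt (pl G)" .
  then show ?thesis
    using pcc_le[of "2 * pl G"] cocomparability_power_interval pl_ge_1[OF assms] by force
qed

text \<open>A walk avoiding the middle vertex \<open>y\<close> has a power edge \<open>q q'\<close>
  across it, and a geodesic from \<open>q\<close> to \<open>q'\<close> comes within \<open>l\<close>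
  of \<open>y\<close>. Both ends are at least \<open>2 * l\<close> from \<open>y\<close>, so
  \<open>d q q' \<ge> 4 * l - 2 * l\<close>, one more than the edge allows.\<close>

lemma pat_le_2pl:
  assumes "card V \<ge> 2"
  shows "pat G \<le> 2 * pl G - 1"
proof (rule pat_le)
  define l where "l = pl G"
  let ?k = "2 * pl G - 1"
  let ?H = "graph_power G ?k"
  have l: "l \<ge> 1" using pl_ge_1[OF assms] by (simp add: l_def)
  then show "?k \<ge> 1" by (simp add: l_def)
  then interpret H: conn_graph ?H by (rule conn_graph_power)
  from pl_interval_rep obtain lf rt where rep: "interval_rep G lf rt l" unfolding l_def .
  show "AT_free ?H"
  proof (rule ccontr)
    assume "\<not> AT_free ?H"
    then obtain x y z where V: "x \<in> V" "y \<in> V" "z \<in> V" and le: "lf x \<le> lf y" "lf y \<le> lf z"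
      and w: "(x, z) \<in> rtrancl_on (far (parcs ?H) V y) (parcs ?H)"
      using H.AT_middle[of lf] graph_power_verts by metis
    then have "z \<in> far (parcs ?H) V y" by (blast dest: in_rtrancl_on_in_F)
    \<comment> \<open>As \<open>l \<ge> 1\<close>, the exponent \<open>2 * l - 1\<close> is at least
      \<open>l\<close>; hence \<open>y\<close> and \<open>z\<close> have disjoint intervals, and the
      walk ends strictly to the right of \<open>y\<close>.\<close>
    then have "d y z > l" using far_power[OF V(2)] l d_sym[OF V(2,3)] by (auto simp: l_def)
    then have "\<not> (lf z \<le> rt y \<and> lf y \<le> rt z)"
      using rep V unfolding interval_rep_def by (meson not_le)
    moreover have yz: "lf y \<le> rt y" "lf z \<le> rt z" using rep V by (auto simp: interval_rep_def)
    ultimately have "\<not> lf z \<le> lf y" using le by linarith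
    then obtain q q' where q: "q \<in> far (parcs ?H) V y" "q' \<in> far (parcs ?H) V y"
      "(q, q') \<in> parcs ?H" "lf q \<le> lf y" "\<not> lf q' \<le> lf y"
      using rtrancl_on_crossing[OF w, of "\<lambda>q. lf q \<le> lf y"] le by blast
    then have q2: "q \<in> V" "q' \<in> V" "d q y > ?k" "d q' y > ?k" "d q q' \<le> ?k"
      using far_power[OF V(2)] by auto
    have "lf q' \<le> rt q'" using rep q2 by (auto simp: interval_rep_def)
    then obtain m where m: "m \<in> V" "d q m + d m q' = d q q'" "d m y \<le> l"
      using interval_midpoint[OF rep q2(1) V(2) q2(2)] q yz by force
    moreover have "d q y \<le> d q m + d m y" "d q' y \<le> d m q' + d m y"
      using d_tri V m(1) q2 d_sym[OF m(1) q2(2)] by metis+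
    ultimately show False using q2 l unfolding l_def by linarith
  qed
qed

lemma pcc_attained: "pcc G \<ge> 1 \<and> cocomparability (graph_power G (pcc G))"
proof -
  from pl_interval_rep obtain lf rt where rep: "interval_rep G lf rt (pl G)" .
  \<comment> \<open>The length is raised by one to obtain a positive exponent also for the
    one-vertex graph, where \<open>pl G = 0\<close>.\<close>
  then have "interval_rep G lf rt (Suc (pl G))" by (force simp: interval_rep_def)
  then have "\<exists>k. k \<ge> 1 \<and> cocomparability (graph_power G k)"
    using cocomparability_power_interval[of lf rt "Suc (pl G)"]
    by (intro exI[of _ "2 * Suc (pl G)"]) (simp del: mult_Suc_right)
  then show ?thesis unfolding pcc_def by (rule LeastI_ex)
qed

lemma pat_le_pcc: "pat G \<le> pcc G"
  using pcc_attained conn_graph_power conn_graph.cocomparability_AT_free pat_le by metis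

lemma pat_attained: "pat G \<ge> 1 \<and> AT_free (graph_power G (pat G))"
proof -
  have "\<exists>k. k \<ge> 1 \<and> AT_free (graph_power G k)"
    using pcc_attained conn_graph_power conn_graph.cocomparability_AT_free by metis
  then show ?thesis unfolding pat_def by (rule LeastI_ex)
qed

end

section \<open>Dominating shortest paths and layerings\<close>

text \<open>One of the two truncated differences is always 0; this form stays within linear
  arithmetic on \<open>nat\<close>.\<close>

abbreviation absdiff :: "nat \<Rightarrow> nat \<Rightarrow> nat" where
  "absdiff i j \<equiv> (i - j) + (j - i)"

lemma absdiff_min: "absdiff (min a m) (min b m) \<le> absdiff a b"
  by (auto simp: min_def)

text \<open>Fixing the indices of the vertices of \<open>p\<close> gives its ends the extreme
  indices and makes \<open>f\<close> usable as the coordinates of a caterpillar.\<close>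

definition spine :: "'a pair_pre_digraph \<Rightarrow> nat \<Rightarrow> 'a list \<Rightarrow> ('a \<Rightarrow> nat) \<Rightarrow> bool" where
  "spine G k p f \<longleftrightarrow> shortest_path G p \<and>
    (\<forall>v\<in>pverts G. f v < length p \<and> gdist G v (p ! f v) \<le> k) \<and> (\<forall>i<length p. f (p ! i) = i)"

context conn_graph
begin

lemma dominating_pair_shortest_path:
  assumes "dominating_pair G k x y"
  shows "\<exists>p. dominating_path G k p \<and> shortest_path G p"
proof -
  have "x \<in> V" "y \<in> V" using assms by (auto simp: dominating_pair_def)
  then obtain p where "shortest_path G p" "hd p = x" "last p = y" using shortest_path_ex by metis
  moreover then have "path_between G x p y"
    by (simp add: shortest_path_def path_between_def)
  ultimately show ?thesis using assms by (auto simp: dominating_pair_def)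
qed

lemma dsp_le_dpr: "dsp G \<le> dpr G"
proof -
  from dpr_dominating_pair obtain x y where "dominating_pair G (dpr G) x y" .
  from dominating_pair_shortest_path[OF this] show ?thesis
    unfolding dsp_def by (rule Least_le)
qed

lemma dsp_attained: "\<exists>p. dominating_path G (dsp G) p \<and> shortest_path G p"
proof -
  from dpr_dominating_pair obtain x y where "dominating_pair G (dpr G) x y" .
  from dominating_pair_shortest_path[OF this] show ?thesis
    unfolding dsp_def by (rule LeastI)
qed

lemma nearest_index:
  assumes p: "distinct p" "set p \<subseteq> V" and dom: "\<And>v. v \<in> V \<Longrightarrow> \<exists>u\<in>set p. d v u \<le> k"
  shows "\<exists>f. (\<forall>v\<in>V. f v < length p \<and> d v (p ! f v) \<le> k) \<and> (\<forall>i<length p. f (p ! i) = i)"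
proof -
  have "\<exists>i. i < length p \<and> d v (p ! i) \<le> k \<and> (v \<in> set p \<longrightarrow> p ! i = v)" if v: "v \<in> V" for v
  proof (cases "v \<in> set p")
    case True
    then obtain i where "i < length p" "p ! i = v" by (auto simp: in_set_conv_nth)
    with v show ?thesis by (intro exI[of _ i]) simp
  next
    case False
    from dom[OF v] obtain u where "u \<in> set p" "d v u \<le> k" by blast
    with False show ?thesis by (auto simp: in_set_conv_nth)
  qed
  then obtain f where
    f: "\<And>v. v \<in> V \<Longrightarrow> f v < length p \<and> d v (p ! f v) \<le> k \<and> (v \<in> set p \<longrightarrow> p ! f v = v)"
    by metis
  have "f (p ! i) = i" if "i < length p" for i
  proof -
    have "p ! i \<in> set p" using that by simp
    with f[of "p ! i"] p have "f (p ! i) < length p" "p ! f (p ! i) = p ! i" by auto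
    then show ?thesis using that p(1) nth_eq_iff_index_eq by blast
  qed
  then show ?thesis using f by blast
qed

lemma spine_ex:
  assumes "dominating_path G k p" "shortest_path G p"
  shows "\<exists>f. spine G k p f"
proof -
  have "distinct p" "set p \<subseteq> V"
    using assms(2) by (auto simp: shortest_path_def vpath_def vwalk_def)
  then show ?thesis
    using nearest_index[of p k] assms unfolding spine_def dominating_path_iff by blast
qed

lemma dsp_spine: obtains p f where "spine G (dsp G) p f"
  using dsp_attained spine_ex by blast

context
  fixes k p f assumes sp: "spine G k p f"
begin

lemma spine_path: "shortest_path G p" "p \<noteq> []" "distinct p" "set p \<subseteq> V"
proof -
  show "shortest_path G p" using sp by (simp add: spine_def)
  then show "p \<noteq> []" "distinct p" "set p \<subseteq> V"
    by (auto simp: shortest_path_def vpath_def vwalk_def)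
qed

lemma spine_f: "v \<in> V \<Longrightarrow> f v < length p" "v \<in> V \<Longrightarrow> d v (p ! f v) \<le> k"
  "v \<in> V \<Longrightarrow> p ! f v \<in> V" "i < length p \<Longrightarrow> f (p ! i) = i"
proof -
  assume "v \<in> V"
  with sp show "f v < length p" by (simp add: spine_def)
  then show "p ! f v \<in> V" using spine_path(4) by auto
qed (use sp in \<open>simp_all add: spine_def\<close>)

lemma spine_nth: "i < length p \<Longrightarrow> p ! i \<in> V"
  using spine_path(4) by auto

lemma spine_dist:
  assumes "i < length p" "j < length p"
  shows "d (p ! i) (p ! j) = absdiff i j"
proof (cases "i \<le> j")
  case False
  then have "d (p ! j) (p ! i) = i - j"
    using shortest_path_nth[OF spine_path(1)] assms by simp
  then show ?thesis using False d_sym[OF spine_nth[OF assms(2)] spine_nth[OF assms(1)]] by simp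
qed (use shortest_path_nth[OF spine_path(1)] assms in simp)

lemma spine_near:
  assumes "u \<in> V" "i < length p"
  shows "d u (p ! i) \<le> k + absdiff (f u) i"
  using d_tri[OF assms(1) spine_f(3)[OF assms(1)] spine_nth[OF assms(2)]] spine_f(2)[OF assms(1)]
    spine_dist[OF spine_f(1)[OF assms(1)] assms(2)] by linarith

lemma spine_upper:
  assumes "u \<in> V" "v \<in> V"
  shows "d u v \<le> 2 * k + absdiff (f u) (f v)"
  using d_tri[OF assms(1) spine_f(3)[OF assms(2)] assms(2)] spine_f(2)[OF assms(2)]
    d_sym[OF assms(2) spine_f(3)[OF assms(2)]] spine_near[OF assms(1) spine_f(1)[OF assms(2)]]
  by linarith

lemma spine_lower:
  assumes "u \<in> V" "v \<in> V"
  shows "absdiff (f u) (f v) \<le> 2 * k + d u v"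
proof -
  note P = spine_f(3)[OF assms(1)] spine_f(3)[OF assms(2)]
  have "absdiff (f u) (f v) = d (p ! f u) (p ! f v)"
    using spine_dist[OF spine_f(1)[OF assms(1)] spine_f(1)[OF assms(2)]] by simp
  also have "\<dots> \<le> d (p ! f u) u + d u v + d v (p ! f v)"
    using d_tri[OF P(1) assms(1) P(2)] d_tri[OF assms P(2)] by linarith
  also have "\<dots> \<le> 2 * k + d u v"
    using spine_f(2)[OF assms(1)] spine_f(2)[OF assms(2)] d_sym[OF assms(1) P(1)] by linarith
  finally show ?thesis .
qed

text \<open>A path between the ends of the spine passes every index up to a jump of \<open>2 * k + 1\<close>.\<close>

lemma spine_dominating_pair: "dominating_pair G (3 * k) (hd p) (last p)"
  unfolding dominating_pair_def dominating_path_iff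
proof (intro conjI allI impI ballI)
  show "hd p \<in> V" "last p \<in> V" using spine_path by auto
  fix q assume q: "path_between G (hd p) q (last p)"
  then show "vpath q (with_proj G)" by (simp add: path_between_def)
  note qV = path_between_ends[OF q]
  fix v assume v: "v \<in> V"
  have near: "d v w \<le> 3 * k" if "w \<in> V" "absdiff (f v) (f w) \<le> k" for w
    using spine_upper[OF v that(1)] that(2) by linarith
  have hd: "f (hd p) = 0" and last: "f (last p) = length p - 1"
    using spine_f(4)[of 0] spine_f(4)[of "length p - 1"] spine_path(2)
    by (auto simp: hd_conv_nth last_conv_nth)
  show "\<exists>u\<in>set q. d v u \<le> 3 * k"
  proof (cases "f (last p) \<le> f v")
    case True
    then have "f v = f (last p)" using spine_f(1)[OF v] last by linarith
    then show ?thesis using near[of "last p"] qV by auto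
  next
    case False
    then obtain x y where xy: "x \<in> set q" "y \<in> set q" "(x, y) \<in> E" "f x \<le> f v" "\<not> f y \<le> f v"
      using rtrancl_on_crossing[OF path_between_rtrancl_on[OF q], of "\<lambda>w. f w \<le> f v"] hd by auto
    then have V: "x \<in> V" "y \<in> V" using qV by auto
    \<comment> \<open>An edge that jumps over \<open>f v\<close> by at most \<open>2 * k + 1\<close>
      has an end at index difference at most \<open>k\<close>.\<close>
    have "absdiff (f x) (f y) \<le> 2 * k + 1" using spine_lower[OF V] d_E[OF xy(3)] by simp
    then have "absdiff (f v) (f x) \<le> k \<or> absdiff (f v) (f y) \<le> k" using xy by linarith
    then show ?thesis using near V xy by blast
  qed
qed

text \<open>The index \<open>f u\<close> and the distance of \<open>u\<close> from the start differ
  by at most \<open>k\<close>, and \<open>u\<close> is within \<open>k\<close> of its spine vertex.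
  The \<open>min\<close> covers levels beyond the end of the spine.\<close>

lemma spine_level:
  assumes "u \<in> V"
  shows "d u (p ! min (d (hd p) u) (length p - 1)) \<le> 2 * k"
proof -
  let ?a = "d (hd p) u"
  have hd: "hd p = p ! 0" "0 < length p" using spine_path(2) by (auto simp: hd_conv_nth)
  have V: "hd p \<in> V" using spine_path by auto
  note P = spine_f(3)[OF assms(1)]
  have f: "d (hd p) (p ! f u) = f u" using spine_dist[OF hd(2) spine_f(1)[OF assms]] hd by simp
  have "f u \<le> ?a + k" "?a \<le> f u + k"
    using d_tri[OF V assms P] d_tri[OF V P assms] f spine_f(2)[OF assms] d_sym[OF assms P]
    by linarith+
  then have "absdiff (f u) (min ?a (length p - 1)) \<le> k" using spine_f(1)[OF assms] by linarith
  moreover have "min ?a (length p - 1) < length p" using hd(2) by linarith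
  ultimately show ?thesis using spine_near[OF assms] by fastforce
qed

text \<open>An edge raises the index by at most \<open>2 * k + 1\<close>. Up to a difference of
  \<open>2 * k\<close>, \<open>spine_upper\<close> gives \<open>4 * k\<close>; in the one remaining
  case \<open>v\<close> has the index of the neighbor \<open>w\<close>, and the detour through
  \<open>w\<close> costs \<open>2 * k + 1\<close>, which is at most \<open>4 * k\<close> because
  \<open>k \<ge> 1\<close>.\<close>

lemma spine_pl:
  assumes "k \<ge> 1"
  shows "pl G \<le> 4 * k"
proof (rule pl_le_ordering[of f])
  fix u v w assume V: "u \<in> V" "v \<in> V" "w \<in> V" and w: "w = u \<or> (u, w) \<in> E"
    and le: "f u \<le> f v" "f v \<le> f w"
  show "d u v \<le> 4 * k"
  proof (cases "f v \<le> f u + 2 * k")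
    case True
    then show ?thesis using spine_upper[OF V(1,2)] le by linarith
  next
    case False
    have duw: "d u w \<le> 1" using w d_E V by auto
    then have "f w \<le> f u + 2 * k + 1" using spine_lower[OF V(1,3)] by linarith
    with False le have "f v = f w" by linarith
    then have "d w v \<le> 2 * k" using spine_upper[OF V(3,2)] by simp
    then show ?thesis using d_tri[OF V(1,3,2)] duw assms by linarith
  qed
qed

end

section \<open>Extended layers: length and breadth\<close>

lemma layer_bag:
  assumes "u \<in> ext_layer G s i" "i \<ge> 1"
  shows "u \<in> V" "d s u = i \<or> (Suc (d s u) = i \<and> (\<exists>w\<in>V. (u, w) \<in> E \<and> d s w = i))"
  using assms by (auto simp: ext_layer_def layer_def)

lemma ext_layering_Union: "\<Union> (set (ext_layering G s)) \<subseteq> V"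
  by (auto simp: ext_layering_def ext_layer_def layer_def)

lemma Delta_le:
  assumes s: "s \<in> V"
    and same: "\<And>u v. u \<in> V \<Longrightarrow> v \<in> V \<Longrightarrow> d s u = d s v \<Longrightarrow> d u v \<le> l"
    and next_level: "\<And>u v w. u \<in> V \<Longrightarrow> (v, w) \<in> E \<Longrightarrow> d s u = d s w \<Longrightarrow> d s w = Suc (d s v) \<Longrightarrow> d u v \<le> l"
  shows "Delta G \<le> l"
proof -
  have "d u v \<le> l" if "i \<ge> 1" "u \<in> ext_layer G s i" "v \<in> ext_layer G s i" for i u v
  proof -
    note u = layer_bag[OF that(2,1)] and v = layer_bag[OF that(3,1)]
    consider "d s u = d s v" | "Suc (d s v) = i" "d s u = i" | "Suc (d s u) = i" "d s v = i"
      using u(2) v(2) by (metis nat.inject)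
    then show ?thesis
    proof cases
      case 1
      then show ?thesis using same u v by blast
    next
      case 2
      then obtain w where "(v, w) \<in> E" "d s w = i" using v(2) by auto
      then show ?thesis using next_level[of u v w] 2 u(1) by simp
    next
      case 3
      then obtain w where "(u, w) \<in> E" "d s w = i" using u(2) by auto
      then have "d v u \<le> l" using next_level[of v u w] 3 v(1) by simp
      then show ?thesis using d_sym u(1) v(1) by simp
    qed
  qed
  then have "decomp_length G (ext_layering G s) \<le> l"
    by (subst decomp_length_le_iff[OF ext_layering_Union]) (auto simp: ext_layering_def)
  moreover have "Delta G \<le> decomp_length G (ext_layering G s)"
    unfolding Delta_def using s by (intro Min_le) auto
  ultimately show ?thesis by linarith
qed

text \<open>Moving each of two vertices of a bag to the spine vertex of its level costs twice
  \<open>2 * dsp G\<close>; the levels differ by at most 1.\<close>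

lemma Delta_le_dsp: "Delta G \<le> 4 * dsp G + 1"
proof -
  from dsp_spine obtain p f where sp: "spine G (dsp G) p f" .
  note path = spine_path[OF sp]
  let ?s = "hd p" and ?m = "length p - 1"
  have bound: "d u v \<le> 4 * dsp G + 1" if V: "u \<in> V" "v \<in> V"
    and le: "d ?s v \<le> d ?s u" "d ?s u \<le> Suc (d ?s v)" for u v
  proof -
    let ?a = "min (d ?s u) ?m" and ?b = "min (d ?s v) ?m"
    have ab: "?a < length p" "?b < length p" using path(2) by (auto simp: min_less_iff_disj)
    note P = spine_nth[OF sp ab(1)] spine_nth[OF sp ab(2)]
    have "absdiff (d ?s u) (d ?s v) \<le> 1" using le by linarith
    then have "d (p ! ?a) (p ! ?b) \<le> 1"
      unfolding spine_dist[OF sp ab] using absdiff_min order_trans by blast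
    moreover have "d u v \<le> d u (p ! ?a) + d (p ! ?a) (p ! ?b) + d (p ! ?b) v"
      using d_tri[OF V(1) P(1) V(2)] d_tri[OF P V(2)] by linarith
    ultimately show ?thesis
      using spine_level[OF sp V(1)] spine_level[OF sp V(2)] d_sym[OF V(2) P(2)] by linarith
  qed
  show ?thesis
  proof (rule Delta_le[of ?s])
    show "?s \<in> V" using path by auto
    show "d u v \<le> 4 * dsp G + 1" if "u \<in> V" "v \<in> V" "d ?s u = d ?s v" for u v
      using bound that by simp
    show "d u v \<le> 4 * dsp G + 1"
      if "u \<in> V" "(v, w) \<in> E" "d ?s u = d ?s w" "d ?s w = Suc (d ?s v)" for u v w
      using bound[of u v] that E_V by simp
  qed
qed

text \<open>The spine vertex at the level of the bag is its center, so only one vertex has to be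
  moved to the spine.\<close>

lemma rho_le_dsp: "rho G \<le> 2 * dsp G + 1"
proof -
  from dsp_spine obtain p f where sp: "spine G (dsp G) p f" .
  note path = spine_path[OF sp]
  let ?s = "hd p" and ?m = "length p - 1"
  have "\<exists>v\<in>V. X \<subseteq> disk G v (2 * dsp G + 1)" if "X \<in> set (ext_layering G ?s)" for X
  proof -
    from that obtain i where i: "i \<ge> 1" "X = ext_layer G ?s i" by (auto simp: ext_layering_def)
    let ?b = "min i ?m"
    have b: "?b < length p" using path(2) by (auto simp: min_less_iff_disj)
    note P = spine_nth[OF sp b]
    have "u \<in> disk G (p ! ?b) (2 * dsp G + 1)" if "u \<in> X" for u
    proof -
      have u: "u \<in> V" "d ?s u \<le> i" "i \<le> Suc (d ?s u)"
        using layer_bag[of u ?s i] that i by auto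
      let ?a = "min (d ?s u) ?m"
      have a: "?a < length p" using path(2) by (auto simp: min_less_iff_disj)
      have "absdiff (d ?s u) i \<le> 1" using u by linarith
      then have "d (p ! ?a) (p ! ?b) \<le> 1"
        unfolding spine_dist[OF sp a b] using absdiff_min order_trans by blast
      then have "d u (p ! ?b) \<le> 2 * dsp G + 1"
        using d_tri[OF u(1) spine_nth[OF sp a] P] spine_level[OF sp u(1)] by linarith
      then show ?thesis using u(1) d_sym[OF u(1) P] by (simp add: disk_def)
    qed
    then show ?thesis using P by blast
  qed
  then have "decomp_breadth G (ext_layering G ?s) \<le> 2 * dsp G + 1"
    unfolding decomp_breadth_def by (intro Least_le) blast
  moreover have "rho G \<le> decomp_breadth G (ext_layering G ?s)"
  proof -
    have "?s \<in> V" using path by auto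
    then show ?thesis unfolding rho_def by (intro Min_le) auto
  qed
  ultimately show ?thesis by linarith
qed

text \<open>With \<open>d s\<close> as key, \<open>v\<close> lies in the layer of \<open>u\<close>,
  or in the next layer, where \<open>u\<close> has the neighbor \<open>w\<close>. In both cases an
  extended layer contains \<open>u\<close> and \<open>v\<close>, unless both equal
  \<open>s\<close>.\<close>

lemma pl_le_Delta: "pl G \<le> Delta G"
proof -
  have "Delta G \<in> (\<lambda>s. decomp_length G (ext_layering G s)) ` V"
    unfolding Delta_def using V_ne by (intro Min_in) auto
  then obtain s where s: "s \<in> V" "Delta G = decomp_length G (ext_layering G s)" by blast
  have bag: "d u v \<le> Delta G"
    if "u \<in> ext_layer G s i" "v \<in> ext_layer G s i" "1 \<le> i" "w \<in> V" "d s w = i" for u v w i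
  proof -
    have "d s w \<le> eccentricity G s" unfolding eccentricity_def using that by (intro Max_ge) auto
    then have "i \<in> set [1..<Suc (eccentricity G s)]"
      unfolding set_upt using that(3,5) by (simp add: less_Suc_eq_le)
    then have "ext_layer G s i \<in> set (ext_layering G s)"
      unfolding ext_layering_def set_map by (rule imageI)
    moreover have "\<forall>X\<in>set (ext_layering G s). \<forall>u\<in>X. \<forall>v\<in>X. d u v \<le> Delta G"
      using decomp_length_le_iff[OF ext_layering_Union, of s "Delta G"] s(2) by simp
    ultimately show ?thesis using that by blast
  qed
  show ?thesis
  proof (rule pl_le_ordering[of "d s"])
    fix u v w assume V: "u \<in> V" "v \<in> V" "w \<in> V" and w: "w = u \<or> (u, w) \<in> E"
      and le: "d s u \<le> d s v" "d s v \<le> d s w"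
    have lew: "d s w \<le> Suc (d s u)"
      using w d_tri[OF s(1) V(1,3)] d_E by fastforce
    show "d u v \<le> Delta G"
    proof (cases "d s v = d s u")
      case True
      \<comment> \<open>Layer 0 has no bag of its own, but it consists of \<open>s\<close>
        alone.\<close>
      show ?thesis
      proof (cases "d s u = 0")
        case True
        then have "u = v" using d_eq_0[OF s(1)] V \<open>d s v = d s u\<close> by simp
        then show ?thesis using V by simp
      next
        case False
        then show ?thesis
          using bag[of u "d s u" v u] True V by (simp add: ext_layer_def layer_def)
      qed
    next
      case False
      then have "d s v = Suc (d s u)" "d s w = Suc (d s u)" using le lew by linarith+
      moreover then have "(u, w) \<in> E" using w by auto
      ultimately show ?thesis
        using bag[of u "d s v" v v] V by (auto simp: ext_layer_def layer_def)
    qed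
  qed
qed

lemma dpr_le_dsp: "dpr G \<le> 3 * dsp G"
  using dsp_spine spine_dominating_pair dpr_le by metis

lemma pl_le_dsp: "dsp G \<ge> 1 \<Longrightarrow> pl G \<le> 4 * dsp G"
  using dsp_spine spine_pl by metis

end

section \<open>Admissible vertices of AT-free graphs\<close>

text \<open>
  \<open>(u, s) \<in> rtrancl_on (far r A v) r\<close> says that some walk from \<open>u\<close> to \<open>s\<close> in \<open>A\<close> avoids the
  closed neighborhood of \<open>v\<close>.
\<close>

definition admissible :: "'a rel \<Rightarrow> 'a set \<Rightarrow> 'a \<Rightarrow> bool" where
  "admissible r A s \<longleftrightarrow> s \<in> A \<and>
    \<not> (\<exists>u\<in>A. \<exists>v\<in>A. (u, s) \<in> rtrancl_on (far r A v) r \<and> (v, s) \<in> rtrancl_on (far r A u) r)"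

text \<open>
  Take a component \<open>C\<close> of some \<open>A - N[s]\<close> of maximum size and let \<open>B\<close> be its neighborhood.
  By maximality every vertex of \<open>W = A - C - B\<close> is adjacent to all of \<open>B\<close>, and an admissible
  vertex of \<open>W\<close>, which exists by induction, is admissible in \<open>A\<close>.
\<close>

lemma admissible_ex:
  assumes "finite A" "A \<noteq> {}" "sym r"
    "\<not> (\<exists>a\<in>A. \<exists>b\<in>A. \<exists>c\<in>A. (a, b) \<in> rtrancl_on (far r A c) r \<and>
      (b, c) \<in> rtrancl_on (far r A a) r \<and> (a, c) \<in> rtrancl_on (far r A b) r)"
  shows "\<exists>s. admissible r A s"
  using assms(1,2,4)
proof (induction A rule: finite_psubset_induct)
  case (psubset A)
  note sym = symD[OF \<open>sym r\<close>]
  show ?case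
  proof (cases "\<exists>s\<in>A. far r A s \<noteq> {}")
    \<comment> \<open>Here all vertices are pairwise adjacent, no walk avoids a closed neighborhood,
      and any vertex is admissible.\<close>
    case False
    then have "\<And>v. v \<in> A \<Longrightarrow> far r A v = {}" by blast
    moreover obtain s where "s \<in> A" using psubset.prems by blast
    ultimately have "admissible r A s"
      unfolding admissible_def by (metis empty_iff in_rtrancl_on_in_F(1))
    then show ?thesis ..
  next
    case True
    define C where "C s c = {x. (c, x) \<in> rtrancl_on (far r A s) r}" for s c
    have C_far: "C s c \<subseteq> far r A s" for s c
      by (auto simp: C_def dest: in_rtrancl_on_in_F)
    have C_A: "C s c \<subseteq> A" for s c using C_far by (fastforce simp: far_def)
    have "Sigma A (far r A) \<noteq> {}" using True by blast
    moreover have "finite (Sigma A (far r A))"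
      using psubset.hyps by (auto simp: far_def)
    ultimately obtain sc where sc: "sc \<in> Sigma A (far r A)"
      "\<And>y. y \<in> Sigma A (far r A) \<Longrightarrow> card (C (fst y) (snd y)) \<le> card (C (fst sc) (snd sc))"
      using ex_maximizer[of "Sigma A (far r A)" "\<lambda>y. card (C (fst y) (snd y))"] by blast
    then obtain s c where s: "s \<in> A" and c: "c \<in> far r A s"
      and max: "\<And>s' c'. s' \<in> A \<Longrightarrow> c' \<in> far r A s' \<Longrightarrow> card (C s' c') \<le> card (C s c)"
      by (cases sc) auto
    define B where "B = {b \<in> A - C s c. \<exists>x\<in>C s c. (x, b) \<in> r}"
    define W where "W = A - C s c - B"
    have cC: "c \<in> C s c" using c by (simp add: C_def)
    have no_edge: "(x, y) \<notin> r" "(y, x) \<notin> r" if "x \<in> C s c" "y \<in> W" for x y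
      using that sym by (auto simp: W_def B_def)
    have "s \<in> W"
      using s C_far[of s c] sym by (fastforce simp: W_def B_def far_def)
    have C_far_W: "C s c \<subseteq> far r A x" if "x \<in> W" for x
      using no_edge[OF _ that] that C_A by (fastforce simp: far_def W_def)
    \<comment> \<open>A walk from \<open>c\<close> avoiding \<open>N[s]\<close> stays in the
      component, so it can be reused while avoiding \<open>N[x]\<close> for any \<open>x\<close> in
      \<open>W\<close>.\<close>
    have C_conn: "(c, x) \<in> rtrancl_on (C s c) r" if "x \<in> C s c" for x
    proof -
      have "(c, x) \<in> rtrancl_on (far r A s) r" using that by (simp add: C_def)
      then show ?thesis
      proof (induction rule: rtrancl_on_induct)
        case base
        then show ?case using cC by simp
      next
        case (step y z)
        then have "z \<in> C s c" by (auto simp: C_def intro: rtrancl_on_into_rtrancl_on)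
        then show ?case using step by (auto intro: rtrancl_on_into_rtrancl_on)
      qed
    qed
    \<comment> \<open>Otherwise \<open>C s c\<close> together with \<open>b\<close> would lie in one
      component of \<open>A - N[x]\<close>, which contradicts the maximal size.\<close>
    have WB: "(x, b) \<in> r" if x: "x \<in> W" and b: "b \<in> B" for x b
    proof (rule ccontr)
      assume "(x, b) \<notin> r"
      then have bf: "b \<in> far r A x" using x b by (auto simp: far_def W_def B_def)
      have sub: "C s c \<subseteq> C x c"
      proof
        fix y assume "y \<in> C s c"
        from rtrancl_on_mono[OF order_refl C_far_W[OF x] C_conn[OF this]]
        show "y \<in> C x c" by (simp add: C_def)
      qed
      from b obtain y where y: "y \<in> C s c" "(y, b) \<in> r" by (auto simp: B_def)
      then have "(c, b) \<in> rtrancl_on (far r A x) r"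
        using sub bf by (auto simp: C_def intro: rtrancl_on_into_rtrancl_on)
      then have "insert b (C s c) \<subseteq> C x c" using sub by (auto simp: C_def)
      moreover have "b \<notin> C s c" using b by (simp add: B_def)
      ultimately have "C s c \<subset> C x c" by blast
      moreover have "finite (C x c)" using C_A psubset.hyps finite_subset by blast
      ultimately have "card (C s c) < card (C x c)" by (rule psubset_card_mono[rotated])
      moreover have "c \<in> far r A x" "x \<in> A" using C_far_W[OF x] cC x by (auto simp: W_def)
      ultimately show False using max by fastforce
    qed
    have far_mono: "far r W v \<subseteq> far r A v" for v by (auto simp: far_def W_def)
    note up = rtrancl_on_mono[OF order_refl far_mono]
    have WA: "W \<subseteq> A" by (auto simp: W_def)
    have "W \<subset> A" using cC C_A by (auto simp: W_def)
    moreover have "\<not> (\<exists>a\<in>W. \<exists>b\<in>W. \<exists>c\<in>W. (a, b) \<in> rtrancl_on (far r W c) r \<and>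
        (b, c) \<in> rtrancl_on (far r W a) r \<and> (a, c) \<in> rtrancl_on (far r W b) r)"
    proof
      assume "\<exists>a\<in>W. \<exists>b\<in>W. \<exists>c\<in>W. (a, b) \<in> rtrancl_on (far r W c) r \<and>
        (b, c) \<in> rtrancl_on (far r W a) r \<and> (a, c) \<in> rtrancl_on (far r W b) r"
      then obtain a b c where "a \<in> W" "b \<in> W" "c \<in> W" "(a, b) \<in> rtrancl_on (far r W c) r"
        "(b, c) \<in> rtrancl_on (far r W a) r" "(a, c) \<in> rtrancl_on (far r W b) r" by blast
      then show False using psubset.prems(2) up[of a b] up[of b c] up[of a c] WA by blast
    qed
    ultimately obtain t where t: "admissible r W t"
      using psubset.IH[of W] \<open>s \<in> W\<close> by blast
    then have tW: "t \<in> W" by (simp add: admissible_def)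
    \<comment> \<open>Followed backwards from \<open>t\<close>, a walk could leave \<open>W\<close>
      only through \<open>B\<close>, and all of \<open>B\<close> is adjacent to the avoided vertex
      \<open>v\<close>.\<close>
    have stay: "(u, t) \<in> rtrancl_on (far r W v) r"
      if "(u, t) \<in> rtrancl_on (far r A v) r" "v \<in> W" for u v
      using that(1)
    proof (induction rule: converse_rtrancl_on_induct)
      case base
      then show ?case using tW by (auto simp: far_def)
    next
      case (step y z)
      then have "z \<in> W" by (auto simp: far_def dest: in_rtrancl_on_in_F)
      have "y \<notin> B" using WB[OF that(2)] step.hyps by (auto simp: far_def)
      moreover have "y \<notin> C s c" using no_edge \<open>z \<in> W\<close> step.hyps by blast
      moreover have "y \<in> A" using step.hyps by (simp add: far_def)
      ultimately have "y \<in> far r W v" using step.hyps by (auto simp: far_def W_def)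
      then show ?case using step converse_rtrancl_on_into_rtrancl_on by metis
    qed
    have "\<not> ((u, t) \<in> rtrancl_on (far r A v) r \<and> (v, t) \<in> rtrancl_on (far r A u) r)"
      if uv: "u \<in> A" "v \<in> A" for u v
    proof
      assume P: "(u, t) \<in> rtrancl_on (far r A v) r \<and> (v, t) \<in> rtrancl_on (far r A u) r"
      then have "t \<in> far r A v" "t \<in> far r A u" by (auto dest: in_rtrancl_on_in_F)
      then have "v \<notin> B" "u \<notin> B" using WB[OF tW] sym by (auto simp: far_def)
      then have uvW: "u \<in> W \<or> u \<in> C s c" "v \<in> W \<or> v \<in> C s c" using uv by (auto simp: W_def)
      \<comment> \<open>If both vertices lie in the component, they are joined inside it away from
        \<open>N[t]\<close> and form an asteroidal triple with \<open>t\<close>. Otherwise one is in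
        \<open>W\<close>, then so is the other by \<open>stay\<close>, and admissibility of
        \<open>t\<close> in \<open>W\<close> applies.\<close>
      show False
      proof (cases "u \<in> C s c \<and> v \<in> C s c")
        case True
        then have "(u, v) \<in> rtrancl_on (C s c) r"
          using C_conn sym_rtrancl_onD[OF \<open>sym r\<close>] rtrancl_on_trans by metis
        then have "(u, v) \<in> rtrancl_on (far r A t) r"
          by (rule rtrancl_on_mono[OF order_refl C_far_W[OF tW]])
        then show False using psubset.prems(2) uv P tW WA by blast
      next
        case False
        have "x \<in> W" if "(x, t) \<in> rtrancl_on (far r A y) r" "y \<in> W" for x y
          using in_rtrancl_on_in_F(1)[OF stay[OF that]] by (simp add: far_def)
        then have W: "u \<in> W" "v \<in> W" using False uvW P by blast+
        then show False using stay[of u v] stay[of v u] P t by (auto simp: admissible_def)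
      qed
    qed
    then have "admissible r A t" using tW WA by (auto simp: admissible_def)
    then show ?thesis ..
  qed
qed

section \<open>The precedence order of an admissible vertex and its rank\<close>

definition precedes :: "'a rel \<Rightarrow> 'a set \<Rightarrow> 'a \<Rightarrow> 'a \<Rightarrow> 'a \<Rightarrow> bool" where
  "precedes r A s u v \<longleftrightarrow> u \<in> A \<and> v \<in> A \<and> (u, s) \<in> rtrancl_on (far r A v) r"

lemma precedes_asym: "admissible r A s \<Longrightarrow> precedes r A s u v \<Longrightarrow> \<not> precedes r A s v u"
  by (auto simp: admissible_def precedes_def)

text \<open>
  If the walk from \<open>u\<close> avoiding \<open>N[v]\<close> met \<open>N[w]\<close>, it would give a walk from \<open>w\<close> avoiding \<open>N[v]\<close>.
\<close>

lemma precedes_trans: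
  assumes s: "admissible r A s" and sym: "sym r"
    and uv: "precedes r A s u v" and vw: "precedes r A s v w"
  shows "precedes r A s u w"
proof (rule ccontr)
  assume not: "\<not> precedes r A s u w"
  have A: "u \<in> A" "v \<in> A" "w \<in> A" using uv vw by (auto simp: precedes_def)
  have vs: "(v, s) \<in> rtrancl_on (far r A w) r" using vw by (simp add: precedes_def)
  then have sf: "s \<in> far r A w" "v \<in> far r A w" by (auto dest: in_rtrancl_on_in_F)
  then have wf: "w \<in> far r A v" using A symD[OF sym] by (auto simp: far_def)
  have "(u, s) \<in> rtrancl_on (far r A v) r" using uv by (simp add: precedes_def)
  then have "(u, s) \<in> rtrancl_on (far r A w) r \<or> (w, s) \<in> rtrancl_on (far r A v) r"
  proof (induction rule: converse_rtrancl_on_induct)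
    case base
    then show ?case using sf by simp
  next
    case (step y z)
    have ys: "(y, s) \<in> rtrancl_on (far r A v) r"
      using step by (auto intro: converse_rtrancl_on_into_rtrancl_on)
    show ?case
    proof (cases "y \<in> far r A w")
      case True
      then show ?thesis using step by (auto intro: converse_rtrancl_on_into_rtrancl_on)
    next
      case False
      then have "y = w \<or> (w, y) \<in> r" using step by (auto simp: far_def)
      then show ?thesis using ys wf by (auto intro: converse_rtrancl_on_into_rtrancl_on)
    qed
  qed
  then have "precedes r A s w v" using not A by (auto simp: precedes_def)
  then show False using precedes_asym[OF s vw] by blast
qed

context conn_graph
begin

text \<open>Counting predecessors turns the strict order into a numeric key. A walk of
  \<open>G\<close> at distance more than \<open>k\<close> from \<open>v\<close> is also a walk of
  the power that avoids the closed neighborhood of \<open>v\<close> there.\<close>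

lemma AT_free_rank:
  assumes "k \<ge> 1" "AT_free (graph_power G k)"
  obtains s and rank :: "'a \<Rightarrow> nat" where "s \<in> V"
    "\<And>u v. u \<in> V \<Longrightarrow> v \<in> V \<Longrightarrow> (u, s) \<in> rtrancl_on {x \<in> V. d x v > k} E \<Longrightarrow> rank u < rank v"
proof -
  let ?r = "parcs (graph_power G k)"
  interpret H: conn_graph "graph_power G k" by (rule conn_graph_power[OF assms(1)])
  have sym: "sym ?r" by (rule H.sym_E)
  obtain s where s: "admissible ?r V s"
    using admissible_ex[OF fin V_ne sym assms(2)[unfolded H.AT_free_iff graph_power_verts]] by blast
  define rank where "rank u = card {w \<in> V. precedes ?r V s w u}" for u
  have "rank u < rank v"
    if V: "u \<in> V" "v \<in> V" and us: "(u, s) \<in> rtrancl_on {x \<in> V. d x v > k} E" for u v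
  proof -
    have "(u, s) \<in> rtrancl_on (far ?r V v) ?r"
      using us far_power[OF V(2)] by (intro rtrancl_on_mono[OF E_subset_power[OF assms(1)] _ us]) simp
    then have uv: "precedes ?r V s u v" using V by (simp add: precedes_def)
    then have "u \<notin> {w \<in> V. precedes ?r V s w u}" using precedes_asym[OF s] by blast
    moreover have "{w \<in> V. precedes ?r V s w u} \<subseteq> {w \<in> V. precedes ?r V s w v}"
      using precedes_trans[OF s sym _ uv] by blast
    ultimately have "{w \<in> V. precedes ?r V s w u} \<subset> {w \<in> V. precedes ?r V s w v}"
      using uv V by blast
    then show ?thesis unfolding rank_def by (intro psubset_card_mono) auto
  qed
  moreover have "s \<in> V" using s by (simp add: admissible_def)
  ultimately show ?thesis using that by blast
qed

context
  fixes k s and rank :: "'a \<Rightarrow> nat"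
  assumes k: "k \<ge> 1" and s: "s \<in> V"
    and rank: "\<And>u v. u \<in> V \<Longrightarrow> v \<in> V \<Longrightarrow> (u, s) \<in> rtrancl_on {x \<in> V. d x v > k} E \<Longrightarrow> rank u < rank v"
begin

text \<open>A vertex of the geodesic from \<open>u\<close> to \<open>s\<close> within
  \<open>k\<close> of \<open>v\<close> would be more than \<open>k\<close> steps away from
  \<open>u\<close>. This would give \<open>d s v < d s u\<close>.\<close>

lemma separated_walk:
  assumes V: "u \<in> V" "v \<in> V" and le: "d s u \<le> d s v" and far: "d u v > 2 * k"
  shows "(u, s) \<in> rtrancl_on {x \<in> V. d x v > k} E"
proof (rule rtrancl_on_mono[OF order_refl _ geodesic[OF V(1) s]])
  have "d w v > k" if w: "w \<in> V" "d u w + d w s = d u s" for w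
  proof (rule ccontr)
    assume "\<not> d w v > k"
    then have "d u w > k" using d_tri[OF V(1) w(1) V(2)] far by linarith
    moreover have "d s v \<le> d s w + d w v" using d_tri[OF s w(1) V(2)] .
    ultimately show False
      using \<open>\<not> d w v > k\<close> w(2) le d_sym[OF s w(1)] d_sym[OF s V(1)] by linarith
  qed
  then show "{w \<in> V. d u w + d w s = d u s} \<subseteq> {x \<in> V. d x v > k}" by blast
qed

lemma same_layer:
  assumes V: "u \<in> V" "v \<in> V" and eq: "d s u = d s v"
  shows "d u v \<le> 2 * k"
proof (rule ccontr)
  assume "\<not> d u v \<le> 2 * k"
  then have "rank u < rank v" "rank v < rank u"
    using separated_walk rank V eq d_sym[OF V] by simp_all
  then show False by simp
qed

lemma layer_Delta: "Delta G \<le> 2 * k + 1"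
proof (rule Delta_le[OF s])
  show "d u v \<le> 2 * k + 1" if "u \<in> V" "v \<in> V" "d s u = d s v" for u v
    using same_layer[OF that] by simp
  show "d u v \<le> 2 * k + 1" if "u \<in> V" "(v, w) \<in> E" "d s u = d s w" for u v w
  proof -
    have V: "v \<in> V" "w \<in> V" using that(2) E_V by auto
    show ?thesis
      using same_layer[OF that(1) V(2) that(3)] d_tri[OF that(1) V(2,1)] d_E[OF E_symD[OF that(2)]]
      by linarith
  qed
qed

text \<open>If \<open>u\<close> and \<open>v\<close> share a bag at distance more than
  \<open>2 * k\<close>, then \<open>v\<close> is in the layer of the neighbor \<open>w\<close> of
  \<open>u\<close>, with \<open>rank v \<le> rank w\<close>. Prefixing \<open>w\<close> to the walk
  from \<open>u\<close> still avoids the \<open>k\<close>-disk of \<open>v\<close> and gives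
  \<open>rank w < rank v\<close>.\<close>

lemma rank_pl: "pl G \<le> 2 * k"
proof -
  define n where "n = Suc (Max (rank ` V))"
  have n: "rank u < n" if "u \<in> V" for u
    unfolding n_def using that by (simp add: less_Suc_eq_le)
  \<comment> \<open>As \<open>n\<close> exceeds every rank, \<open>f\<close> orders
    lexicographically by distance from \<open>s\<close> and then by rank.\<close>
  define f where "f u = d s u * n + rank u" for u
  have f: "d s u < d s v \<or> d s u = d s v \<and> rank u \<le> rank v"
    if "u \<in> V" "v \<in> V" "f u \<le> f v" for u v
  proof (cases "d s v < d s u")
    case True
    then have "Suc (d s v) * n \<le> d s u * n" by (intro mult_le_mono1) simp
    then show ?thesis using that n[of v] by (simp add: f_def)
  next
    case False
    then show ?thesis using that by (cases "d s u = d s v") (auto simp: f_def)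
  qed
  show ?thesis
  proof (rule pl_le_ordering[of f], rule ccontr)
    fix u v w assume V: "u \<in> V" "v \<in> V" "w \<in> V" and w: "w = u \<or> (u, w) \<in> E"
      and le: "f u \<le> f v" "f v \<le> f w" and far: "\<not> d u v \<le> 2 * k"
    note uv = f[OF V(1,2) le(1)] and vw = f[OF V(2,3) le(2)]
    have ne: "d s u \<noteq> d s v" using same_layer[OF V(1,2)] far by blast
    have "w \<noteq> u" using uv vw ne by auto
    then have uw: "(u, w) \<in> E" using w by simp
    then have "d s w \<le> Suc (d s u)" using d_tri[OF s V(1,3)] d_E by fastforce
    then have eq: "d s v = d s w" "rank v \<le> rank w" using uv vw ne by linarith+
    have "d w v > k" using d_tri[OF V(1,3,2)] d_E[OF uw] far k by linarith
    moreover have "(u, s) \<in> rtrancl_on {x \<in> V. d x v > k} E"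
      using separated_walk[OF V(1,2)] uv far by linarith
    ultimately have "(w, s) \<in> rtrancl_on {x \<in> V. d x v > k} E"
      using V(3) E_symD[OF uw] by (intro converse_rtrancl_on_into_rtrancl_on[of w u]) auto
    then show False using rank[OF V(3,2)] eq by simp
  qed
qed

text \<open>If a geodesic from \<open>z\<close> to \<open>x\<close> missed the \<open>k\<close>-disk
  of \<open>y\<close>, it could be continued by the walk from \<open>x\<close> to \<open>s\<close>,
  and \<open>z\<close> would have smaller rank than \<open>y\<close>. So it meets the disk, and both
  of its parts are longer than \<open>k\<close>.\<close>

lemma rank_pcc: "pcc G \<le> 2 * k"
proof (rule pcc_le)
  show "2 * k \<ge> 1" using k by simp
  \<comment> \<open>One of the two vertices has a walk avoiding the disk of the other; the ranks
    decide that it is \<open>u\<close>.\<close>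
  have walk: "(u, s) \<in> rtrancl_on {x \<in> V. d x v > k} E"
    if "u \<in> V" "v \<in> V" "rank u \<le> rank v" "d u v > 2 * k" for u v
  proof (cases "d s u \<le> d s v")
    case False
    then have "(v, s) \<in> rtrancl_on {x \<in> V. d x u > k} E"
      using separated_walk[OF that(2,1)] that(4) d_sym[OF that(1,2)] by simp
    then show ?thesis using rank[OF that(2,1)] that(3) by simp
  qed (use separated_walk that in blast)
  show "cocomparability (graph_power G (2 * k))"
  proof (rule cocomparability_key[of _ rank])
    fix x y z
    assume "x \<in> pverts (graph_power G (2 * k))" "y \<in> pverts (graph_power G (2 * k))"
      "z \<in> pverts (graph_power G (2 * k))"
    then have V: "x \<in> V" "y \<in> V" "z \<in> V" by auto
    assume ne: "x \<noteq> y" "y \<noteq> z" and le: "rank x \<le> rank y" "rank y \<le> rank z"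
      and na: "(x, y) \<notin> parcs (graph_power G (2 * k))" "(y, z) \<notin> parcs (graph_power G (2 * k))"
    then have gt: "d x y > 2 * k" "d y z > 2 * k" using V by auto
    have "\<not> {w \<in> V. d z w + d w x = d z x} \<subseteq> {w \<in> V. d w y > k}"
    proof
      assume "{w \<in> V. d z w + d w x = d z x} \<subseteq> {w \<in> V. d w y > k}"
      then have "(z, x) \<in> rtrancl_on {w \<in> V. d w y > k} E"
        using rtrancl_on_mono[OF order_refl _ geodesic[OF V(3,1)]] by blast
      then have "(z, s) \<in> rtrancl_on {w \<in> V. d w y > k} E"
        using walk[OF V(1,2) le(1) gt(1)] by (rule rtrancl_on_trans)
      then show False using rank[OF V(3,2)] le by simp
    qed
    then obtain m where m: "m \<in> V" "d z m + d m x = d z x" "d m y \<le> k" by force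
    have "d x y \<le> d m x + d m y" "d y z \<le> d m y + d z m" "d x z = d z x"
      using d_tri[OF V(1) m(1) V(2)] d_tri[OF V(2) m(1) V(3)]
        d_sym[OF V(1) m(1)] d_sym[OF m(1) V(3)] d_sym[OF V(2) m(1)] d_sym[OF V(1,3)] by linarith+
    then have "d x z > 2 * k" using m gt by linarith
    then show "(x, z) \<notin> parcs (graph_power G (2 * k))" by simp
  qed simp
qed

end

lemma pat_bounds: "Delta G \<le> 2 * pat G + 1" "pl G \<le> 2 * pat G" "pcc G \<le> 2 * pat G"
proof -
  have k: "pat G \<ge> 1" and free: "AT_free (graph_power G (pat G))" using pat_attained by auto
  obtain s and rank :: "'a \<Rightarrow> nat" where s: "s \<in> V" and
    rank: "\<And>u v. u \<in> V \<Longrightarrow> v \<in> V \<Longrightarrow> (u, s) \<in> rtrancl_on {x \<in> V. d x v > pat G} E \<Longrightarrow> rank u < rank v"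
    by (rule AT_free_rank[OF k free]) (rule that)
  show "Delta G \<le> 2 * pat G + 1" by (rule layer_Delta[OF k s, where rank = rank]) (rule rank)
  show "pl G \<le> 2 * pat G" by (rule rank_pl[OF k s, where rank = rank]) (rule rank)
  show "pcc G \<le> 2 * pat G" by (rule rank_pcc[OF k s, where rank = rank]) (rule rank)
qed

end

section \<open>Caterpillar trees\<close>

text \<open>
  Every caterpillar is described by a spine \<open>p\<close> and a map \<open>f\<close> sending each vertex to the
  index of the spine vertex that it equals or is attached to.
\<close>

definition spine_coords :: "'a set \<Rightarrow> 'a list \<Rightarrow> ('a \<Rightarrow> nat) \<Rightarrow> bool" where
  "spine_coords A p f \<longleftrightarrow> p \<noteq> [] \<and> distinct p \<and> set p \<subseteq> A \<and>
    (\<forall>v\<in>A. f v < length p) \<and> (\<forall>i<length p. f (p ! i) = i)"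

definition pend :: "'a list \<Rightarrow> 'a \<Rightarrow> nat" where
  "pend p v = (if v \<in> set p then 0 else 1)"

text \<open>Tree distance: to the spine, along it, and off it again. Equal vertices are separate
  because the sum would be 2 for a pendant vertex.\<close>

definition cdist :: "'a list \<Rightarrow> ('a \<Rightarrow> nat) \<Rightarrow> 'a \<Rightarrow> 'a \<Rightarrow> nat" where
  "cdist p f u v = (if u = v then 0 else pend p u + pend p v + absdiff (f u) (f v))"

definition caterpillar_of :: "'a set \<Rightarrow> 'a list \<Rightarrow> ('a \<Rightarrow> nat) \<Rightarrow> 'a pair_pre_digraph" where
  "caterpillar_of A p f = \<lparr> pverts = A, parcs = {(u, v). u \<in> A \<and> v \<in> A \<and> cdist p f u v = 1} \<rparr>"

lemma caterpillar_of_simps [simp]: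
  "pverts (caterpillar_of A p f) = A"
  "(u, v) \<in> parcs (caterpillar_of A p f) \<longleftrightarrow> u \<in> A \<and> v \<in> A \<and> cdist p f u v = 1"
  by (auto simp: caterpillar_of_def)

lemma cdist_sym: "cdist p f u v = cdist p f v u"
  by (auto simp: cdist_def)

lemma cdist_tri: "cdist p f u v \<le> cdist p f u w + cdist p f w v"
  by (auto simp: cdist_def)

section \<open>Distances and acyclicity of caterpillars\<close>

lemma vwalk_nthI:
  assumes "set p \<subseteq> verts H" "p \<noteq> []"
    "\<And>i. Suc i < length p \<Longrightarrow> (p ! i, p ! Suc i) \<in> arcs_ends H"
  shows "vwalk p H"
  using assms
proof (induction p)
  case (Cons a p)
  show ?case
  proof (cases "p = []")
    case False
    have "(p ! i, p ! Suc i) \<in> arcs_ends H" if "Suc i < length p" for i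
      using Cons.prems(3)[of "Suc i"] that by simp
    moreover have "(a, hd p) \<in> arcs_ends H"
      using Cons.prems(3)[of 0] False by (simp add: hd_conv_nth)
    ultimately show ?thesis
      using Cons.IH Cons.prems(1) False by (intro vwalk_consI) auto
  qed (use Cons.prems in \<open>auto simp: vwalk_def\<close>)
qed simp

text \<open>The neighbors are the cyclic predecessor and successor, which differ because the length
  is at least 3.\<close>

lemma cycle_neighbors:
  assumes q: "vwalk q H" "distinct q" "length q \<ge> 3" "(last q, hd q) \<in> arcs_ends H"
    and sym: "sym (arcs_ends H)" and x: "x \<in> set q"
  obtains a b where "a \<in> set q" "b \<in> set q" "a \<noteq> b" "(x, a) \<in> arcs_ends H" "(x, b) \<in> arcs_ends H"
proof -
  obtain i where i: "i < length q" "x = q ! i" using x by (auto simp: in_set_conv_nth)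
  define n where "n = length q"
  have n: "n \<ge> 3" "i < n" using q(3) i by (auto simp: n_def)
  have ne: "q ! a \<noteq> q ! b" if "a \<noteq> b" "a < n" "b < n" for a b
    using q(2) that by (simp add: n_def nth_eq_iff_index_eq)
  have mem: "q ! a \<in> set q" if "a < n" for a using that by (simp add: n_def)
  have arc: "(q ! a, q ! Suc a) \<in> arcs_ends H" if "Suc a < n" for a
    using vwalk_nth_arc[OF q(1)] that by (simp add: n_def)
  have closing: "(q ! (n - 1), q ! 0) \<in> arcs_ends H"
  proof -
    have "q \<noteq> []" using q(3) by auto
    then show ?thesis using q(4) by (simp add: n_def hd_conv_nth last_conv_nth)
  qed
  note rev = symD[OF sym]
  consider "i = 0" | "i = n - 1" | "0 < i" "i < n - 1" using n by linarith
  then show ?thesis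
  proof cases
    case 1
    then show ?thesis
      using that[of "q ! 1" "q ! (n - 1)"] mem ne[of 1 "n - 1"] arc[of 0] rev[OF closing] n i(2) by simp
  next
    case 2
    then have "Suc (n - 2) = i" using n by simp
    then show ?thesis
      using that[of "q ! (n - 2)" "q ! 0"] mem ne[of "n - 2" 0] rev[OF arc[of "n - 2"]] closing n i(2) 2
      by simp
  next
    case 3
    then have "Suc (i - 1) = i" by simp
    then show ?thesis
      using that[of "q ! (i - 1)" "q ! Suc i"] mem ne[of "i - 1" "Suc i"] rev[OF arc[of "i - 1"]]
        arc[of i] n i(2) 3 by simp
  qed
qed

context
  fixes A :: "'a set" and p f
  assumes coords: "spine_coords A p f" and fin_A: "finite A"
begin

lemma coords_nth: "v \<in> A \<Longrightarrow> f v < length p" "i < length p \<Longrightarrow> p ! i \<in> set p"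
  "i < length p \<Longrightarrow> p ! i \<in> A" "i < length p \<Longrightarrow> f (p ! i) = i"
  using coords nth_mem by (auto simp: spine_coords_def)

lemma coords_spine: "v \<in> set p \<Longrightarrow> p ! f v = v"
  using coords by (auto simp: spine_coords_def in_set_conv_nth)

text \<open>Any positive value can be lowered by one across an arc; together with the triangle
  inequality this identifies \<open>cdist\<close> with the graph distance.\<close>

lemma cdist_step:
  assumes V: "u \<in> A" "v \<in> A" and n: "cdist p f u v = Suc n"
  shows "\<exists>w\<in>A. cdist p f u w = 1 \<and> cdist p f w v = n"
proof -
  have uv: "u \<noteq> v" using n by (auto simp: cdist_def)
  consider "u \<notin> set p" | "u \<in> set p" "f u = f v" | "u \<in> set p" "f u < f v" | "u \<in> set p" "f v < f u"
    by linarith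
  then show ?thesis
  proof cases
    case 1
    note w = coords_nth(2-4)[OF coords_nth(1)[OF V(1)]]
    have "u \<noteq> p ! f u" using 1 w(1) by auto
    then have "cdist p f u (p ! f u) = 1" "cdist p f (p ! f u) v = n"
      using 1 w n uv coords_spine[of v] by (auto simp: cdist_def pend_def)
    then show ?thesis using w by blast
  next
    case 2
    then have "v \<notin> set p" using uv coords_spine by metis
    then show ?thesis using 2 uv n V by (intro bexI[of _ v]) (auto simp: cdist_def pend_def)
  next
    case 3
    then have "Suc (f u) < length p" using coords_nth(1)[OF V(2)] by simp
    note w = coords_nth(2-4)[OF this]
    have "u \<noteq> p ! Suc (f u)" using w(3) by auto
    then have "cdist p f u (p ! Suc (f u)) = 1" "cdist p f (p ! Suc (f u)) v = n"
      using 3 w n uv coords_spine[of v] by (auto simp: cdist_def pend_def)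
    then show ?thesis using w by blast
  next
    case 4
    then have "f u - 1 < length p" using coords_nth(1)[OF V(1)] by simp
    note w = coords_nth(2-4)[OF this]
    have "u \<noteq> p ! (f u - 1)" using w(3) 4 by auto
    then have "cdist p f u (p ! (f u - 1)) = 1" "cdist p f (p ! (f u - 1)) v = n"
      using 4 w n uv coords_spine[of v] by (auto simp: cdist_def pend_def)
    then show ?thesis using w by blast
  qed
qed

lemma cdist_eq_0: "u \<in> A \<Longrightarrow> v \<in> A \<Longrightarrow> cdist p f u v = 0 \<longleftrightarrow> u = v"
  using coords_spine by (auto simp: cdist_def pend_def split: if_splits) metis

lemma caterpillar_of_conn_graph: "conn_graph (caterpillar_of A p f)"
proof -
  let ?T = "caterpillar_of A p f"
  have sym: "sym (parcs ?T)" by (auto intro!: symI simp: cdist_sym)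
  have "parcs ?T \<subseteq> A \<times> A" by auto
  then have "finite (parcs ?T)" by (rule finite_subset) (use fin_A in simp)
  with sym have "pair_graph ?T"
    by unfold_locales (auto simp: symmetric_def fin_A cdist_def)
  moreover have "(u, v) \<in> rtrancl_on A ((parcs ?T)\<^sup>s)" if "u \<in> A" "v \<in> A" for u v
    using that
  proof (induction "cdist p f u v" arbitrary: u)
    case 0
    then show ?case using cdist_eq_0 by simp
  next
    case (Suc n)
    then obtain w where w: "w \<in> A" "cdist p f u w = 1" "cdist p f w v = n"
      using cdist_step[of u v n] by metis
    then have "(w, v) \<in> rtrancl_on A ((parcs ?T)\<^sup>s)" using Suc by simp
    moreover have "(u, w) \<in> (parcs ?T)\<^sup>s" using w Suc.prems by (simp add: symcl_def)
    ultimately show ?case using Suc.prems(1) by (metis converse_rtrancl_on_into_rtrancl_on)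
  qed
  moreover have "A \<noteq> {}" using coords by (auto simp: spine_coords_def)
  ultimately show ?thesis by (simp add: conn_graph_def conn_graph_axioms_def connected_conv)
qed

lemma gdist_caterpillar_of:
  assumes "u \<in> A" "v \<in> A"
  shows "gdist (caterpillar_of A p f) u v = cdist p f u v"
proof -
  interpret T: conn_graph "caterpillar_of A p f" by (rule caterpillar_of_conn_graph)
  show ?thesis
  proof (rule antisym)
    show "T.d u v \<le> cdist p f u v"
      using assms
    proof (induction "cdist p f u v" arbitrary: u)
      case 0
      then show ?case using cdist_eq_0 by simp
    next
      case (Suc n)
      then obtain w where w: "w \<in> A" "cdist p f u w = 1" "cdist p f w v = n"
        using cdist_step[of u v n] by metis
      then have "T.d w v \<le> n" using Suc.hyps(1)[of w] Suc.prems by simp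
      moreover have "T.d u v \<le> Suc (T.d w v)" using T.d_edge[of u w v] w Suc.prems by simp
      ultimately show ?case using Suc.hyps(2) by linarith
    qed
    show "cdist p f u v \<le> T.d u v"
      using assms
    proof (induction "T.d u v" arbitrary: u)
      case 0
      then show ?case using T.d_eq_0[of u v] by (simp add: cdist_def)
    next
      case (Suc n)
      obtain w where w: "cdist p f u w = 1" "w \<in> A" "T.d w v = n"
        using T.d_step[of u v n] Suc.hyps(2) Suc.prems by auto
      then have "cdist p f w v \<le> n" using Suc.hyps(1)[of w] Suc.prems by simp
      then show ?case using cdist_tri[of p f u v w] w(1) Suc.hyps(2) by linarith
    qed
  qed
qed

text \<open>A pendant vertex has a single neighbor, so a cycle would lie on the spine; there its
  vertex of largest index has at most one neighbor on the cycle.\<close>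

lemma caterpillar_caterpillar_of: "caterpillar (caterpillar_of A p f)"
proof -
  let ?T = "caterpillar_of A p f"
  interpret T: conn_graph ?T by (rule caterpillar_of_conn_graph)
  have p: "p \<noteq> []" "distinct p" "set p \<subseteq> A" using coords by (auto simp: spine_coords_def)
  have no_cycle: "\<not> (\<exists>q. vpath q (with_proj ?T) \<and> length q \<ge> 3 \<and> (last q, hd q) \<in> parcs ?T)"
  proof
    assume "\<exists>q. vpath q (with_proj ?T) \<and> length q \<ge> 3 \<and> (last q, hd q) \<in> parcs ?T"
    then obtain q where q: "vwalk q (with_proj ?T)" "distinct q" "length q \<ge> 3" "(last q, hd q) \<in> parcs ?T"
      unfolding vpath_def by blast
    have nbrs: "\<exists>a b. a \<in> set q \<and> b \<in> set q \<and> a \<noteq> b \<and> cdist p f x a = 1 \<and> cdist p f x b = 1"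
      if x: "x \<in> set q" for x
    proof -
      obtain a b where "a \<in> set q" "b \<in> set q" "a \<noteq> b" "(x, a) \<in> parcs ?T" "(x, b) \<in> parcs ?T"
        by (rule cycle_neighbors[OF q(1-3), unfolded with_proj_simps, OF q(4) T.sym_E x])
      then show ?thesis by auto
    qed
    have spine: "x \<in> set p" if x: "x \<in> set q" for x
    proof (rule ccontr)
      assume "x \<notin> set p"
      then have "a = p ! f x" if "cdist p f x a = 1" for a
        using that coords_spine[of a] by (auto simp: cdist_def pend_def split: if_splits)
      then show False using nbrs[OF x] by metis
    qed
    have "finite (set q)" "set q \<noteq> {}" using q(3) by auto
    from ex_maximizer[OF this, of f] obtain x where x: "x \<in> set q" "\<And>y. y \<in> set q \<Longrightarrow> f y \<le> f x" by blast
    have "a = p ! (f x - 1)" if "a \<in> set q" "cdist p f x a = 1" for a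
    proof -
      have "f a = f x - 1"
        using that x(2)[OF that(1)] spine[OF x(1)] spine[OF that(1)]
        by (auto simp: cdist_def pend_def split: if_splits)
      then show ?thesis using coords_spine[OF spine[OF that(1)]] by simp
    qed
    then show False using nbrs[OF x(1)] by metis
  qed
  have "vwalk p (with_proj ?T)"
  proof (rule vwalk_nthI)
    fix i assume i: "Suc i < length p"
    then have "p ! i \<noteq> p ! Suc i" using p(2) by (simp add: nth_eq_iff_index_eq)
    then show "(p ! i, p ! Suc i) \<in> arcs_ends (with_proj ?T)"
      using coords_nth(2-4)[of i] coords_nth(2-4)[of "Suc i"] i by (simp add: cdist_def pend_def)
  qed (use p in auto)
  moreover have "gdist_set ?T v (set p) \<le> 1" if v: "v \<in> A" for v
  proof -
    note w = coords_nth(2-4)[OF coords_nth(1)[OF v]]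
    have "cdist p f v (p ! f v) \<le> 1" using w by (auto simp: cdist_def pend_def)
    then have "T.d v (p ! f v) \<le> 1" using gdist_caterpillar_of[OF v w(2)] by simp
    then have "\<exists>u\<in>set p. T.d v u \<le> 1" using w(1) by blast
    then show ?thesis using T.gdist_set_le[of "set p" v 1] p(1) by simp
  qed
  ultimately show ?thesis
    using no_cycle p(2) T.pair_graph_axioms T.conn
    unfolding caterpillar_def undirected_tree_def vpath_def by auto
qed

end

text \<open>
  An edge of the caterpillar that is neither a spine edge nor the chosen pendant edge closes a
  cycle with a path through the spine.
\<close>

lemma caterpillar_coords:
  assumes "caterpillar T"
  obtains p f where "spine_coords (pverts T) p f" "finite (pverts T)"
    "\<And>u v. u \<in> pverts T \<Longrightarrow> v \<in> pverts T \<Longrightarrow> gdist T u v = cdist p f u v"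
proof -
  from assms have graph: "pair_graph T" "connected (with_proj T)"
    and acyclic: "\<And>q. vpath q (with_proj T) \<Longrightarrow> length q \<ge> 3 \<Longrightarrow> (last q, hd q) \<notin> parcs T"
    unfolding caterpillar_def undirected_tree_def by blast+
  interpret T: conn_graph T using graph by (simp add: conn_graph_def conn_graph_axioms_def)
  from assms obtain p where p: "vpath p (with_proj T)" "\<forall>v \<in> pverts T. gdist_set T v (set p) \<le> 1"
    unfolding caterpillar_def by blast
  then have pw: "vwalk p (with_proj T)" "distinct p" "p \<noteq> []" "set p \<subseteq> pverts T"
    by (auto simp: vpath_def vwalk_def)
  have "\<exists>u\<in>set p. gdist T v u \<le> 1" if "v \<in> pverts T" for v
    using p(2) that pw(3) T.gdist_set_le[of "set p" v 1] by auto
  from T.nearest_index[OF pw(2,4) this] obtain f where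
    f: "\<And>v. v \<in> pverts T \<Longrightarrow> f v < length p \<and> gdist T v (p ! f v) \<le> 1" "\<And>i. i < length p \<Longrightarrow> f (p ! i) = i"
    by blast
  have coords: "spine_coords (pverts T) p f"
    using pw f by (simp add: spine_coords_def)
  note spine = coords_spine[OF coords T.fin]
  let ?C = "caterpillar_of (pverts T) p f"
  interpret C: conn_graph ?C by (rule caterpillar_of_conn_graph[OF coords T.fin])
  have attached: "(u, v) \<in> parcs T"
    if "u \<in> pverts T" "v \<in> pverts T" "u \<noteq> v" "v \<in> set p" "f u = f v" for u v
  proof -
    have "gdist T u v \<le> 1" using f(1)[OF that(1)] spine[OF that(4)] that(5) by simp
    then show ?thesis using T.d_le_1[OF that(1,2)] that(3) by simp
  qed
  have consecutive: "(u, v) \<in> parcs T" if "u \<in> set p" "v \<in> set p" "f v = Suc (f u)" for u v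
  proof -
    have "v \<in> pverts T" using that pw by auto
    then have "Suc (f u) < length p" using f(1) that(3) by metis
    then show ?thesis
      using vwalk_nth_arc[OF pw(1)] spine[OF that(1)] spine[OF that(2)] that(3) by force
  qed
  have CT: "parcs ?C \<subseteq> parcs T"
  proof (intro subrelI)
    fix u v assume "(u, v) \<in> parcs ?C"
    then have uv: "u \<in> pverts T" "v \<in> pverts T" "u \<noteq> v" "pend p u + pend p v + absdiff (f u) (f v) = 1"
      by (auto simp: cdist_def split: if_splits)
    then consider "u \<in> set p" "v \<in> set p" "f v = Suc (f u)" | "u \<in> set p" "v \<in> set p" "f u = Suc (f v)"
      | "v \<in> set p" "f u = f v" | "u \<in> set p" "f u = f v"
      by (cases "u \<in> set p"; cases "v \<in> set p"; simp add: pend_def) linarith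
    then show "(u, v) \<in> parcs T"
    proof cases
      case 2
      then show ?thesis using consecutive[of v u] T.E_symD by blast
    next
      case 4
      then show ?thesis using attached[of v u] uv T.E_symD by metis
    qed (use consecutive attached uv in auto)
  qed
  have "cdist p f u v = 1" if uv: "(u, v) \<in> parcs T" for u v
  proof (rule ccontr)
    assume not1: "cdist p f u v \<noteq> 1"
    have V: "u \<in> pverts T" "v \<in> pverts T" "u \<noteq> v" using uv T.E_V T.E_irrefl by auto
    then have "cdist p f u v \<ge> 2" using not1 cdist_eq_0[OF coords T.fin V(1,2)] by linarith
    moreover obtain q where q: "path_between ?C u q v" "vwalk_length q = gdist ?C u v"
      using C.gdist_path[of u v] V by auto
    ultimately have "length q \<ge> 3"
      using gdist_caterpillar_of[OF coords T.fin V(1,2)] by simp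
    moreover have "vpath q (with_proj T)"
      using q(1) CT by (auto simp: path_between_def vpath_def vwalk_def)
    ultimately show False
      using acyclic[of q] q(1) T.E_symD[OF uv] by (auto simp: path_between_def)
  qed
  then have "parcs T = parcs ?C"
    using CT T.E_V by auto
  then have "T = ?C" by (simp add: caterpillar_of_def)
  then have "gdist T u v = cdist p f u v" if "u \<in> pverts T" "v \<in> pverts T" for u v
    using gdist_caterpillar_of[OF coords T.fin that] by metis
  then show ?thesis using that coords T.fin by blast
qed

section \<open>Approximation of a graph by caterpillars\<close>

context conn_graph
begin

lemma caterpillar_approx:
  assumes coords: "spine_coords V p f"
    and bound: "\<And>u v. u \<in> V \<Longrightarrow> v \<in> V \<Longrightarrow> u \<noteq> v \<Longrightarrow> d u v \<le> cdist p f u v + k \<and> cdist p f u v \<le> d u v + k"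
  shows "\<exists>T. caterpillar T \<and> pverts T = V \<and>
    (\<forall>u \<in> V. \<forall>v \<in> V. \<bar>int (d u v) - int (gdist T u v)\<bar> \<le> int k)"
proof (intro exI conjI ballI)
  show "caterpillar (caterpillar_of V p f)" by (rule caterpillar_caterpillar_of[OF coords fin])
  fix u v assume V: "u \<in> V" "v \<in> V"
  show "\<bar>int (d u v) - int (gdist (caterpillar_of V p f) u v)\<bar> \<le> int k"
    unfolding gdist_caterpillar_of[OF coords fin V]
  proof (cases "u = v")
    case True
    then show "\<bar>int (d u v) - int (cdist p f u v)\<bar> \<le> int k" using V by (simp add: cdist_def)
  next
    case False
    then show "\<bar>int (d u v) - int (cdist p f u v)\<bar> \<le> int k" using bound[OF V] by linarith
  qed
qed simp

lemma adc_le: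
  assumes "spine_coords V p f"
    "\<And>u v. u \<in> V \<Longrightarrow> v \<in> V \<Longrightarrow> u \<noteq> v \<Longrightarrow> d u v \<le> cdist p f u v + k \<and> cdist p f u v \<le> d u v + k"
  shows "adc G \<le> k"
  unfolding adc_def by (rule Least_le) (rule caterpillar_approx[OF assms])

lemma pend_le_1: "pend p v \<le> 1"
  by (simp add: pend_def)

lemma spine_coords_spine: "spine G k p f \<Longrightarrow> spine_coords V p f"
  using spine_path spine_f unfolding spine_coords_def by metis

text \<open>The extra 2 pays for the at most two pendant edges in \<open>cdist\<close>.\<close>

lemma spine_approx:
  assumes sp: "spine G k p f" and V: "u \<in> V" "v \<in> V" "u \<noteq> v"
  shows "d u v \<le> cdist p f u v + (2 * k + 2) \<and> cdist p f u v \<le> d u v + (2 * k + 2)"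
  using spine_upper[OF sp V(1,2)] spine_lower[OF sp V(1,2)] V(3) pend_le_1[of p u] pend_le_1[of p v]
  unfolding cdist_def by auto

lemma adc_le_dsp: "adc G \<le> 2 * dsp G + 2"
proof -
  from dsp_spine obtain p f where sp: "spine G (dsp G) p f" .
  show ?thesis by (rule adc_le[OF spine_coords_spine[OF sp] spine_approx[OF sp]])
qed

lemma adc_coords:
  obtains p f where "spine_coords V p f"
    "\<And>u v. u \<in> V \<Longrightarrow> v \<in> V \<Longrightarrow> d u v \<le> cdist p f u v + adc G"
    "\<And>u v. u \<in> V \<Longrightarrow> v \<in> V \<Longrightarrow> cdist p f u v \<le> d u v + adc G"
proof -
  from dsp_spine obtain p f where sp: "spine G (dsp G) p f" .
  have "\<exists>T. caterpillar T \<and> pverts T = V \<and>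
    (\<forall>u \<in> V. \<forall>v \<in> V. \<bar>int (d u v) - int (gdist T u v)\<bar> \<le> int (adc G))"
    unfolding adc_def
    by (rule LeastI) (rule caterpillar_approx[OF spine_coords_spine[OF sp] spine_approx[OF sp]])
  then obtain T where T: "caterpillar T" "pverts T = V"
    "\<And>u v. u \<in> V \<Longrightarrow> v \<in> V \<Longrightarrow> \<bar>int (d u v) - int (gdist T u v)\<bar> \<le> int (adc G)" by blast
  obtain p f where
    coords: "spine_coords V p f" "\<And>u v. u \<in> V \<Longrightarrow> v \<in> V \<Longrightarrow> gdist T u v = cdist p f u v"
    by (rule caterpillar_coords[OF T(1), unfolded T(2)]) (rule that)
  show ?thesis
  proof (rule that[OF coords(1)])
    fix u v assume V: "u \<in> V" "v \<in> V"
    show "d u v \<le> cdist p f u v + adc G" "cdist p f u v \<le> d u v + adc G"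
      using T(3)[OF V] coords(2)[OF V] by linarith+
  qed
qed

lemma dpr_le_adc: "dpr G \<le> 2 * adc G + 1"
proof -
  define k where "k = adc G"
  from adc_coords obtain p f where coords: "spine_coords V p f"
    and upper: "\<And>u v. u \<in> V \<Longrightarrow> v \<in> V \<Longrightarrow> d u v \<le> cdist p f u v + k"
    and lower: "\<And>u v. u \<in> V \<Longrightarrow> v \<in> V \<Longrightarrow> cdist p f u v \<le> d u v + k" unfolding k_def by blast
  have p: "p \<noteq> []" "set p \<subseteq> V" using coords by (auto simp: spine_coords_def)
  have hd: "f (hd p) = 0" and last: "f (last p) = length p - 1"
    using coords_nth(4)[OF coords fin, of 0] coords_nth(4)[OF coords fin, of "length p - 1"] p(1)
    by (auto simp: hd_conv_nth last_conv_nth)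
  have "dominating_pair G (2 * k + 1) (hd p) (last p)"
    unfolding dominating_pair_def dominating_path_iff
  proof (intro conjI allI impI ballI)
    show "hd p \<in> V" "last p \<in> V" using p by auto
    fix q assume q: "path_between G (hd p) q (last p)"
    then show "vpath q (with_proj G)" by (simp add: path_between_def)
    note qV = path_between_ends[OF q]
    fix v assume v: "v \<in> V"
    show "\<exists>u\<in>set q. d v u \<le> 2 * k + 1"
    proof (cases "f (last p) \<le> f v")
      case True
      then have "f v = f (last p)" using coords_nth(1)[OF coords fin v] last by linarith
      moreover have "last p \<in> set p" using p by simp
      ultimately have "cdist p f v (last p) \<le> 1"
        using pend_le_1[of p v] by (simp add: cdist_def pend_def)
      then have "d v (last p) \<le> 2 * k + 1" using upper[OF v, of "last p"] qV by fastforce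
      then show ?thesis using qV(2) by blast
    next
      case False
      then obtain x y where xy: "x \<in> set q" "y \<in> set q" "(x, y) \<in> E" "f x \<le> f v" "\<not> f y \<le> f v"
        using rtrancl_on_crossing[OF path_between_rtrancl_on[OF q], of "\<lambda>w. f w \<le> f v"] hd by auto
      then have V: "x \<in> V" "y \<in> V" using qV by auto
      have "x \<noteq> y" using xy by blast
      then have "cdist p f x y = pend p x + pend p y + (f y - f x)"
        using xy by (simp add: cdist_def)
      moreover have "cdist p f v x \<le> pend p v + pend p x + (f v - f x)"
        "cdist p f v y \<le> pend p v + pend p y + (f y - f v)"
        using xy by (auto simp: cdist_def)
      moreover have "cdist p f x y \<le> k + 1" using lower[OF V] d_E[OF xy(3)] by simp
      \<comment> \<open>The two sums add up to \<open>cdist p f x y + 2 * pend p v\<close>. If both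
        distances from \<open>v\<close> exceeded \<open>k + 1\<close>, they would add up to at least
        \<open>2 * k + 4\<close>.\<close>
      ultimately have "cdist p f v x + cdist p f v y \<le> k + 3"
        using xy pend_le_1[of p v] by linarith
      then have "d v x \<le> 2 * k + 1 \<or> d v y \<le> 2 * k + 1"
        using upper[OF v V(1)] upper[OF v V(2)] by linarith
      then show ?thesis using xy by blast
    qed
  qed
  then show ?thesis unfolding k_def by (rule dpr_le)
qed

lemma pcc_le_adc: "pcc G \<le> 3 * adc G + 2"
proof (rule pcc_le)
  define k where "k = adc G"
  from adc_coords obtain p f where coords: "spine_coords V p f"
    and upper: "\<And>u v. u \<in> V \<Longrightarrow> v \<in> V \<Longrightarrow> d u v \<le> cdist p f u v + k"
    and lower: "\<And>u v. u \<in> V \<Longrightarrow> v \<in> V \<Longrightarrow> cdist p f u v \<le> d u v + k" unfolding k_def by blast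
  let ?H = "graph_power G (3 * k + 2)"
  have "cocomparability ?H"
  proof (rule cocomparability_key[of _ f])
    fix x y z
    assume "x \<in> pverts ?H" "y \<in> pverts ?H" "z \<in> pverts ?H"
    then have V: "x \<in> V" "y \<in> V" "z \<in> V" by auto
    assume ne: "x \<noteq> y" "y \<noteq> z" and le: "f x \<le> f y" "f y \<le> f z"
      and na: "(x, y) \<notin> parcs ?H" "(y, z) \<notin> parcs ?H"
    show "(x, z) \<notin> parcs ?H"
    proof (cases "x = z")
      case False
      have "cdist p f x y \<ge> 2 * k + 3" "cdist p f y z \<ge> 2 * k + 3"
        using na ne V upper[OF V(1,2)] upper[OF V(2,3)] by auto
      \<comment> \<open>The route through \<open>y\<close> uses its pendant edge twice. Hence
        \<open>d x z \<ge> 2 * (2 * k + 3) - 2 - k = 3 * k + 4\<close>; the case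
        \<open>x = z\<close>, where \<open>cdist\<close> is 0, has been split off.\<close>
      moreover have "cdist p f x z + 2 * pend p y = cdist p f x y + cdist p f y z"
        using False ne le by (simp add: cdist_def)
      ultimately have "d x z > 3 * k + 2" using lower[OF V(1,3)] pend_le_1[of p y] by linarith
      then show ?thesis by simp
    qed simp
  qed simp
  then show "cocomparability (graph_power G (3 * adc G + 2))" by (simp add: k_def)
qed simp

lemma geodesic_point:
  assumes "u \<in> V" "v \<in> V" "j \<le> d u v"
  shows "\<exists>w\<in>V. d u w + j = d u v \<and> d w v = j"
  using assms
proof (induction "d u v - j" arbitrary: u)
  case 0
  then show ?case by (intro bexI[of _ u]) auto
next
  case (Suc n)
  then have "d u v = Suc (d u v - 1)" by linarith
  from d_step[OF Suc.prems(1,2) this] obtain x where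
    x: "(u, x) \<in> E" "x \<in> V" "d x v = d u v - 1" .
  then have "Suc (d x v) = d u v" using \<open>d u v = Suc (d u v - 1)\<close> by simp
  note x = x(1,2) this
  have "n = d x v - j" "j \<le> d x v" using x(3) Suc.hyps(2) by linarith+
  then obtain w where w: "w \<in> V" "d x w + j = d x v" "d w v = j"
    using Suc.hyps(1)[of x] x(2) Suc.prems(2) by blast
  moreover have "d u w \<le> Suc (d x w)" using d_edge[OF x(1) w(1)] .
  moreover have "d u v \<le> d u w + d w v" using d_tri Suc.prems w(1) by blast
  ultimately show ?case using x(3) by (intro bexI[of _ w]) auto
qed

text \<open>Vertices of layer \<open>i + 1\<close> off the geodesic \<open>p\<close> are attached to its vertex in layer \<open>i\<close>.\<close>

lemma adc_le_layers:
  assumes k: "k \<ge> 1" and s: "s \<in> V"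
    and same: "\<And>u v. u \<in> V \<Longrightarrow> v \<in> V \<Longrightarrow> d s u = d s v \<Longrightarrow> d u v \<le> 2 * k"
  shows "adc G \<le> 2 * k"
proof -
  \<comment> \<open>Since \<open>y\<close> is farthest from \<open>s\<close>, the geodesic
    \<open>p\<close> reaches every level, and \<open>f v\<close> below is a valid index.\<close>
  obtain y where y: "y \<in> V" "\<And>v. v \<in> V \<Longrightarrow> d s v \<le> d s y"
    using ex_maximizer[OF fin V_ne, of "d s"] by blast
  from shortest_path_ex[OF s y(1)] obtain p where
    p: "shortest_path G p" "hd p = s" "last p = y" "length p = Suc (d s y)" .
  then have pw: "p \<noteq> []" "distinct p" "set p \<subseteq> V"
    by (auto simp: shortest_path_def vpath_def vwalk_def)
  have level: "d s (p ! i) = i" if "i < length p" for i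
    using shortest_path_nth[OF p(1), of 0 i] that p(2) pw(1) by (simp add: hd_conv_nth)
  define f where "f v = d s v - pend p v" for v
  \<comment> \<open>The subtraction in \<open>f\<close> does not truncate: the only vertex at level
    0 is \<open>s\<close>, which lies on \<open>p\<close>.\<close>
  have f: "d s v = f v + pend p v" if "v \<in> V" for v
  proof (cases "v \<in> set p")
    case False
    then have "v \<noteq> s" using p(2) pw(1) by auto
    then have "d s v \<noteq> 0" using d_eq_0[OF s that] by blast
    then show ?thesis using False by (simp add: f_def pend_def)
  qed (simp add: f_def pend_def)
  have "spine_coords V p f"
    unfolding spine_coords_def
  proof (intro conjI ballI allI impI)
    show "f v < length p" if "v \<in> V" for v
      using y(2)[OF that] p(4) by (simp add: f_def)
    show "f (p ! i) = i" if "i < length p" for i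
      using level[OF that] that by (simp add: f_def pend_def)
  qed (use pw in auto)
  \<comment> \<open>A geodesic from \<open>s\<close> to \<open>v\<close> has a vertex
    \<open>w\<close> in the layer of \<open>u\<close>, to which \<open>same\<close> applies.\<close>
  moreover have upper: "d u v \<le> 2 * k + (d s v - d s u)" if V: "u \<in> V" "v \<in> V" and le: "d s u \<le> d s v" for u v
  proof -
    obtain w where w: "w \<in> V" "d s w + (d s v - d s u) = d s v" "d w v = d s v - d s u"
      using geodesic_point[OF s V(2), of "d s v - d s u"] by auto
    then have "d s u = d s w" using le by linarith
    then show ?thesis using same[OF V(1) w(1)] d_tri[OF V(1) w(1) V(2)] w(3) by linarith
  qed
  have "d u v \<le> cdist p f u v + 2 * k \<and> cdist p f u v \<le> d u v + 2 * k"
    if V: "u \<in> V" "v \<in> V" and ne: "u \<noteq> v" for u v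
  proof -
    have up: "d u v \<le> 2 * k + absdiff (d s u) (d s v)"
    proof (cases "d s u \<le> d s v")
      case False
      then show ?thesis using upper[OF V(2,1)] d_sym[OF V] by simp
    qed (use upper[OF V] in simp)
    have low: "absdiff (d s u) (d s v) \<le> d u v"
      using d_tri[OF s V] d_tri[OF s V(2,1)] d_sym[OF V] by linarith
    have "cdist p f u v = pend p u + pend p v + absdiff (f u) (f v)" using ne by (simp add: cdist_def)
    \<comment> \<open>Pendant terms raise \<open>cdist\<close> above the level difference by at most
      2, which fits into \<open>2 * k\<close> because \<open>k \<ge> 1\<close>.\<close>
    moreover have "absdiff (d s u) (d s v) \<le> pend p u + pend p v + absdiff (f u) (f v)"
      "pend p u + pend p v + absdiff (f u) (f v) \<le> absdiff (d s u) (d s v) + 2"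
      unfolding f[OF V(1)] f[OF V(2)] using pend_le_1[of p u] pend_le_1[of p v] by linarith+
    ultimately show ?thesis using up low k by linarith
  qed
  ultimately show ?thesis by (rule adc_le)
qed

lemma adc_le_pat: "adc G \<le> 2 * pat G"
proof -
  have k: "pat G \<ge> 1" and free: "AT_free (graph_power G (pat G))" using pat_attained by auto
  obtain s and rank :: "'a \<Rightarrow> nat" where s: "s \<in> V" and
    rank: "\<And>u v. u \<in> V \<Longrightarrow> v \<in> V \<Longrightarrow> (u, s) \<in> rtrancl_on {x \<in> V. d x v > pat G} E \<Longrightarrow> rank u < rank v"
    by (rule AT_free_rank[OF k free]) (rule that)
  show ?thesis
  proof (rule adc_le_layers[OF k s])
    show "d u v \<le> 2 * pat G" if "u \<in> V" "v \<in> V" "d s u = d s v" for u v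
      by (rule same_layer[OF k s _ that, where rank = rank]) (rule rank)
  qed
qed

end

text \<open>The guards exclude degenerate graphs: a path with at least one edge has
  \<open>dsp G = 0\<close> but \<open>pl G = 1\<close>, and the one-vertex graph has
  \<open>pl G = Delta G = 0\<close> but \<open>pat G = pcc G = 1\<close>. Bounds with a subtraction
  or a quotient are stated over \<open>real\<close> to prevent truncation.\<close>

theorem theorem3:
  fixes G :: "'a pair_pre_digraph"
  assumes "pair_graph G" and "connected (with_proj G)"
  shows
    "rho G \<le> 2 * dsp G + 1
     \<and> (dsp G \<le> dpr G \<and> dpr G \<le> 3 * dsp G)
     \<and> (dsp G \<le> dpr G \<and> dpr G \<le> pl G
        \<and> (dsp G \<ge> 1 \<longrightarrow> pl G \<le> 4 * dsp G) \<and> 4 * dsp G \<le> 4 * dpr G)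
     \<and> (dsp G \<le> dpr G \<and> dpr G \<le> Delta G
        \<and> Delta G \<le> 4 * dsp G + 1 \<and> 4 * dsp G + 1 \<le> 4 * dpr G + 1)
     \<and> ((real (adc G) - 2) / 2 \<le> real (dsp G) \<and> dsp G \<le> dpr G \<and> dpr G \<le> 2 * adc G + 1)
     \<and> (real (adc G) / 2 \<le> real (pat G) \<and> pat G \<le> pcc G \<and> pcc G \<le> 3 * adc G + 2)
     \<and> (real (pl G) / 2 \<le> real (pat G)
        \<and> (card (pverts G) \<ge> 2 \<longrightarrow> real (pat G) \<le> 2 * real (pl G) - 1))
     \<and> ((real (Delta G) - 1) / 2 \<le> real (pat G)
        \<and> (card (pverts G) \<ge> 2 \<longrightarrow> real (pat G) \<le> 2 * real (Delta G) - 1))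
     \<and> (pat G \<le> pcc G \<and> pcc G \<le> 2 * pat G)
     \<and> (real (pl G) / 2 \<le> real (pat G) \<and> pat G \<le> pcc G
        \<and> (card (pverts G) \<ge> 2 \<longrightarrow> pcc G \<le> 2 * pl G))"
proof -
  interpret conn_graph G using assms by (simp add: conn_graph_def conn_graph_axioms_def)
  have pat_pl: "real (pat G) \<le> 2 * real (pl G) - 1" if "card (pverts G) \<ge> 2"
    using pat_le_2pl[OF that] pl_ge_1[OF that] by linarith
  have "dpr G \<le> Delta G" using dpr_le_pl pl_le_Delta by (rule order_trans)
  moreover have "real (pat G) \<le> 2 * real (Delta G) - 1" if "card (pverts G) \<ge> 2"
    using pat_pl[OF that] pl_le_Delta by linarith
  moreover have "real (adc G) \<le> 2 * real (dsp G) + 2" using adc_le_dsp by linarith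
  moreover have "real (adc G) \<le> 2 * real (pat G)" using adc_le_pat by linarith
  moreover have "real (pl G) \<le> 2 * real (pat G)" "real (Delta G) \<le> 2 * real (pat G) + 1"
    using pat_bounds by linarith+
  ultimately show ?thesis
    using rho_le_dsp dsp_le_dpr dpr_le_dsp dpr_le_pl pl_le_dsp Delta_le_dsp dpr_le_adc
      pat_le_pcc pcc_le_adc pat_pl pat_bounds pcc_le_2pl by (simp add: field_simps)
qed

end
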